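(* The $(3,3,3)$-triangle group $T=\langle a, b, c\mid a^2=b^2=c^2=(ab)^3=(bc)^3=(ac)^3=1\rangle$ has property QT but does not have property PH$_0$.
   Context: A hyperbolic space is a geodesic metric space that is Gromov $\delta$-hyperbolic for some $\delta\ge 0$. A quasi-tree is a metric space quasi-isometric to a tree equipped with the path metric. An isometric action of a group $G$ on a metric space $X$ is proper if for every $x\in X$ and $R>0$ the set $\{g\in G: d(x,gx)\le R\}$ is finite; it is cobounded if some orbit is $\epsilon$-dense in $X$ for some $\epsilon\ge 0$. A group $G$ has property PH$_0$ if there exist finitely many hyperbolic spaces $X_1,\dots,X_n$, each with a cobounded isometric $G$-action, such that the diagonal action of $G$ on $\prod_{i=1}^n X_i$ with the $\ell^1$-metric, $g(x_1,\dots,x_n)=(gx_1,\dots,gx_n)$, is proper. A group $G$ has property QT if it is finitely generated and acts isometrically on a finite product of quasi-trees, equipped with the $\ell^1$-metric, such that the orbit map is a quasi-isometric embedding (with respect to a word metric on $G$ from a finite generating set). *)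

theory Defs
  imports
    "HOL-Analysis.Abstract_Metric_Spaces"
    "HOL-Algebra.Group_Action"
    "HOL-Algebra.Generated_Groups"
begin

section \<open>Hyperbolic spaces\<close>

definition geodesic_space :: "'x metric \<Rightarrow> bool" where
  "geodesic_space X \<longleftrightarrow>
     (\<forall>x\<in>mspace X. \<forall>y\<in>mspace X. \<exists>\<gamma> :: real \<Rightarrow> 'x.
        \<gamma> \<in> {0..mdist X x y} \<rightarrow> mspace X \<and> \<gamma> 0 = x \<and> \<gamma> (mdist X x y) = y \<and>
        (\<forall>s\<in>{0..mdist X x y}. \<forall>t\<in>{0..mdist X x y}. mdist X (\<gamma> s) (\<gamma> t) = \<bar>s - t\<bar>))"

definition gromov_product :: "'x metric \<Rightarrow> 'x \<Rightarrow> 'x \<Rightarrow> 'x \<Rightarrow> real" where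
  "gromov_product X w x y = (mdist X x w + mdist X y w - mdist X x y) / 2"

definition gromov_hyperbolic :: "real \<Rightarrow> 'x metric \<Rightarrow> bool" where
  "gromov_hyperbolic \<delta> X \<longleftrightarrow>
     (\<forall>w\<in>mspace X. \<forall>x\<in>mspace X. \<forall>y\<in>mspace X. \<forall>z\<in>mspace X.
        gromov_product X w x z \<ge> min (gromov_product X w x y) (gromov_product X w y z) - \<delta>)"

definition hyperbolic_space :: "'x metric \<Rightarrow> bool" where
  "hyperbolic_space X \<longleftrightarrow> geodesic_space X \<and> (\<exists>\<delta>\<ge>0. gromov_hyperbolic \<delta> X)"


section \<open>Quasi-isometries\<close>

definition qi_embedding :: "'x metric \<Rightarrow> 'y metric \<Rightarrow> ('x \<Rightarrow> 'y) \<Rightarrow> bool" where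
  "qi_embedding X Y f \<longleftrightarrow> f \<in> mspace X \<rightarrow> mspace Y \<and>
     (\<exists>L\<ge>1. \<exists>C\<ge>0. \<forall>x\<in>mspace X. \<forall>y\<in>mspace X.
        mdist X x y / L - C \<le> mdist Y (f x) (f y) \<and> mdist Y (f x) (f y) \<le> L * mdist X x y + C)"

definition quasi_isometry :: "'x metric \<Rightarrow> 'y metric \<Rightarrow> ('x \<Rightarrow> 'y) \<Rightarrow> bool" where
  "quasi_isometry X Y f \<longleftrightarrow> qi_embedding X Y f \<and>
     (\<exists>D\<ge>0. \<forall>y\<in>mspace Y. \<exists>x\<in>mspace X. mdist Y (f x) y \<le> D)"


section \<open>Trees and quasi-trees\<close>

text \<open>
  A simple graph is given by its vertex set and its set of two-element edges.
  Walks are nonempty lists of vertices; in \<open>is_cycle\<close> the base vertex occurs both first and last.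
\<close>

definition simple_graph :: "'v set \<Rightarrow> 'v set set \<Rightarrow> bool" where
  "simple_graph V E \<longleftrightarrow> (\<forall>e\<in>E. \<exists>u\<in>V. \<exists>v\<in>V. u \<noteq> v \<and> e = {u, v})"

definition is_walk :: "'v set \<Rightarrow> 'v set set \<Rightarrow> 'v list \<Rightarrow> bool" where
  "is_walk V E p \<longleftrightarrow> p \<noteq> [] \<and> set p \<subseteq> V \<and> successively (\<lambda>u v. {u, v} \<in> E) p"

definition walk_betw :: "'v set \<Rightarrow> 'v set set \<Rightarrow> 'v \<Rightarrow> 'v list \<Rightarrow> 'v \<Rightarrow> bool" where
  "walk_betw V E u p v \<longleftrightarrow> is_walk V E p \<and> hd p = u \<and> last p = v"

definition is_cycle :: "'v set \<Rightarrow> 'v set set \<Rightarrow> 'v list \<Rightarrow> bool" where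
  "is_cycle V E p \<longleftrightarrow> is_walk V E p \<and> length p \<ge> 4 \<and> hd p = last p \<and> distinct (tl p)"

definition connected_graph :: "'v set \<Rightarrow> 'v set set \<Rightarrow> bool" where
  "connected_graph V E \<longleftrightarrow> V \<noteq> {} \<and> (\<forall>u\<in>V. \<forall>v\<in>V. \<exists>p. walk_betw V E u p v)"

definition is_tree :: "'v set \<Rightarrow> 'v set set \<Rightarrow> bool" where
  "is_tree V E \<longleftrightarrow> simple_graph V E \<and> connected_graph V E \<and> (\<nexists>p. is_cycle V E p)"

definition graph_dist :: "'v set \<Rightarrow> 'v set set \<Rightarrow> 'v \<Rightarrow> 'v \<Rightarrow> nat" where
  "graph_dist V E u v = (LEAST n. \<exists>p. walk_betw V E u p v \<and> length p = Suc n)"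

definition path_metric :: "'v set \<Rightarrow> 'v set set \<Rightarrow> 'v metric" where
  "path_metric V E = metric (V, \<lambda>u v. real (graph_dist V E u v))"

text \<open>
  The tree is represented by its vertices with the path metric; they are isometrically embedded
  and \<open>1/2\<close>-dense in its geometric realization, so either may be used up to quasi-isometry.

  HOL cannot quantify over all types inside a formula, so a type of vertices has to be chosen.
  Nothing is lost: given a quasi-isometry from \<open>X\<close> to a tree, it may be corestricted to the subtree
  spanned by its image, which has at most as many vertices as \<open>'x \<times> nat\<close> has elements.
\<close>

definition quasi_tree :: "'x metric \<Rightarrow> bool" where
  "quasi_tree X \<longleftrightarrow>
     (\<exists>(V :: ('x \<times> nat) set) E f. is_tree V E \<and> quasi_isometry X (path_metric V E) f)"


section \<open>Isometric actions and products\<close>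

definition isometric_action :: "('g, 'm) monoid_scheme \<Rightarrow> 'x metric \<Rightarrow> ('g \<Rightarrow> 'x \<Rightarrow> 'x) \<Rightarrow> bool" where
  "isometric_action G X \<phi> \<longleftrightarrow> group_action G (mspace X) \<phi> \<and>
     (\<forall>g\<in>carrier G. \<forall>x\<in>mspace X. \<forall>y\<in>mspace X. mdist X (\<phi> g x) (\<phi> g y) = mdist X x y)"

definition proper_action :: "('g, 'm) monoid_scheme \<Rightarrow> 'x metric \<Rightarrow> ('g \<Rightarrow> 'x \<Rightarrow> 'x) \<Rightarrow> bool" where
  "proper_action G X \<phi> \<longleftrightarrow>
     (\<forall>x\<in>mspace X. \<forall>R>0. finite {g \<in> carrier G. mdist X x (\<phi> g x) \<le> R})"

definition cobounded_action :: "('g, 'm) monoid_scheme \<Rightarrow> 'x metric \<Rightarrow> ('g \<Rightarrow> 'x \<Rightarrow> 'x) \<Rightarrow> bool" where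
  "cobounded_action G X \<phi> \<longleftrightarrow>
     (\<exists>x\<in>mspace X. \<exists>\<epsilon>\<ge>0. \<forall>y\<in>mspace X. \<exists>z\<in>orbit G \<phi> x. mdist X y z \<le> \<epsilon>)"

definition l1_product :: "nat \<Rightarrow> (nat \<Rightarrow> 'x metric) \<Rightarrow> (nat \<Rightarrow> 'x) metric" where
  "l1_product n X =
     metric (\<Pi>\<^sub>E i\<in>{..<n}. mspace (X i), \<lambda>x y. \<Sum>i<n. mdist (X i) (x i) (y i))"

definition diagonal_action ::
  "nat \<Rightarrow> (nat \<Rightarrow> 'x metric) \<Rightarrow> (nat \<Rightarrow> 'g \<Rightarrow> 'x \<Rightarrow> 'x) \<Rightarrow> 'g \<Rightarrow> (nat \<Rightarrow> 'x) \<Rightarrow> (nat \<Rightarrow> 'x)" where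
  "diagonal_action n X \<phi> g =
     (\<lambda>x\<in>(\<Pi>\<^sub>E i\<in>{..<n}. mspace (X i)). \<lambda>i\<in>{..<n}. \<phi> i g (x i))"


section \<open>Word metrics\<close>

definition generating_set :: "('g, 'm) monoid_scheme \<Rightarrow> 'g set \<Rightarrow> bool" where
  "generating_set G S \<longleftrightarrow> S \<subseteq> carrier G \<and> generate G S = carrier G"

definition word_length :: "('g, 'm) monoid_scheme \<Rightarrow> 'g set \<Rightarrow> 'g \<Rightarrow> nat" where
  "word_length G S g =
     (LEAST n. \<exists>w. set w \<subseteq> S \<union> m_inv G ` S \<and> length w = n \<and> foldr (mult G) w (one G) = g)"

text \<open>
  The distance is set to \<open>0\<close> outside the carrier because the locale \<open>Metric_space\<close> requires symmetry
  for all elements of the type.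
\<close>

definition word_metric :: "('g, 'm) monoid_scheme \<Rightarrow> 'g set \<Rightarrow> 'g metric" where
  "word_metric G S = metric (carrier G,
     \<lambda>g h. if g \<in> carrier G \<and> h \<in> carrier G
           then real (word_length G S (m_inv G g \<otimes>\<^bsub>G\<^esub> h)) else 0)"


section \<open>The properties PH0 and QT\<close>

text \<open>
  The first argument fixes the type whose subsets serve as the factor spaces. Finitely many spaces
  over different types can be transported to a common type such as a sum, so a single type for all
  factors is no restriction. Absence of PH0 is expressed by \<open>\<not> has_PH0 TYPE('x) G\<close> for an arbitrary
  type \<open>'x\<close>.

  The action in \<open>has_QT\<close> is any isometric action on the product; it may permute the factors.
\<close>

definition has_PH0 :: "'x itself \<Rightarrow> ('g, 'm) monoid_scheme \<Rightarrow> bool" where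
  "has_PH0 (_ :: 'x itself) G \<longleftrightarrow> group G \<and>
     (\<exists>n (X :: nat \<Rightarrow> 'x metric) \<phi>.
        (\<forall>i<n. hyperbolic_space (X i) \<and> isometric_action G (X i) (\<phi> i) \<and>
               cobounded_action G (X i) (\<phi> i)) \<and>
        proper_action G (l1_product n X) (diagonal_action n X \<phi>))"

definition has_QT :: "'x itself \<Rightarrow> ('g, 'm) monoid_scheme \<Rightarrow> bool" where
  "has_QT (_ :: 'x itself) G \<longleftrightarrow> group G \<and>
     (\<exists>S. finite S \<and> generating_set G S \<and>
        (\<exists>n (X :: nat \<Rightarrow> 'x metric) \<phi>.
           (\<forall>i<n. quasi_tree (X i)) \<and>
           isometric_action G (l1_product n X) \<phi> \<and>
           (\<forall>x\<in>mspace (l1_product n X).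
              qi_embedding (word_metric G S) (l1_product n X) (\<lambda>g. \<phi> g x))))"


section \<open>Group presentations\<close>

text \<open>
  Words are lists of letters \<open>(s, True)\<close> for the generator \<open>s\<close> and \<open>(s, False)\<close> for its inverse; the
  generators are all elements of the type \<open>'s\<close>. Two words are related by \<open>pres_eq R\<close> iff they differ
  by finitely many insertions and deletions of subwords \<open>s s\<^sup>-\<^sup>1\<close>, \<open>s\<^sup>-\<^sup>1 s\<close> and of relators from \<open>R\<close>,
  that is, iff they agree in the quotient of the free group by the normal closure of \<open>R\<close>.
\<close>

type_synonym 's gword = "('s \<times> bool) list"

inductive pres_eq :: "'s gword set \<Rightarrow> 's gword \<Rightarrow> 's gword \<Rightarrow> bool" for R where
  pres_refl: "pres_eq R u u"
| pres_sym: "pres_eq R u v \<Longrightarrow> pres_eq R v u"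
| pres_trans: "pres_eq R u v \<Longrightarrow> pres_eq R v w \<Longrightarrow> pres_eq R u w"
| pres_cancel: "pres_eq R (u @ [(s, e), (s, \<not> e)] @ v) (u @ v)"
| pres_relator: "r \<in> R \<Longrightarrow> pres_eq R (u @ r @ v) (u @ v)"

definition pres_rel :: "'s gword set \<Rightarrow> ('s gword \<times> 's gword) set" where
  "pres_rel R = {(u, v). pres_eq R u v}"

definition presented_group :: "'s gword set \<Rightarrow> 's gword set monoid" where
  "presented_group R =
     \<lparr>carrier = UNIV // pres_rel R,
      mult = \<lambda>A B. \<Union>u\<in>A. \<Union>v\<in>B. pres_rel R `` {u @ v},
      one = pres_rel R `` {[]}\<rparr>"

datatype tri_gen = gen_a | gen_b | gen_c

definition letter :: "'s \<Rightarrow> 's gword" where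
  "letter s = [(s, True)]"

definition word_pow :: "'s gword \<Rightarrow> nat \<Rightarrow> 's gword" where
  "word_pow w k = concat (replicate k w)"

definition triangle_group_333 :: "tri_gen gword set monoid" where
  "triangle_group_333 = presented_group
     {word_pow (letter gen_a) 2, word_pow (letter gen_b) 2, word_pow (letter gen_c) 2,
      word_pow (letter gen_a @ letter gen_b) 3,
      word_pow (letter gen_b @ letter gen_c) 3,
      word_pow (letter gen_a @ letter gen_c) 3}"


section \<open>Well-definedness\<close>

lemma Metric_space_l1_product:
  fixes n :: nat
  shows "Metric_space (\<Pi>\<^sub>E i\<in>{..<n}. mspace (X i)) (\<lambda>x y. \<Sum>i<n. mdist (X i) (x i) (y i))"
proof
  fix x y z
  show "0 \<le> (\<Sum>i<n. mdist (X i) (x i) (y i))"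
    by (simp add: sum_nonneg)
  show "(\<Sum>i<n. mdist (X i) (x i) (y i)) = (\<Sum>i<n. mdist (X i) (y i) (x i))"
    by (simp add: mdist_commute)
  assume x: "x \<in> (\<Pi>\<^sub>E i\<in>{..<n}. mspace (X i))" and y: "y \<in> (\<Pi>\<^sub>E i\<in>{..<n}. mspace (X i))"
  have "(\<Sum>i<n. mdist (X i) (x i) (y i)) = 0 \<longleftrightarrow> (\<forall>i\<in>{..<n}. mdist (X i) (x i) (y i) = 0)"
    by (rule sum_nonneg_eq_0_iff) auto
  also have "\<dots> \<longleftrightarrow> (\<forall>i\<in>{..<n}. x i = y i)"
    using x y by (auto simp: PiE_iff)
  also have "\<dots> \<longleftrightarrow> x = y"
    using x y PiE_ext by blast
  finally show "(\<Sum>i<n. mdist (X i) (x i) (y i)) = 0 \<longleftrightarrow> x = y" .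
  assume z: "z \<in> (\<Pi>\<^sub>E i\<in>{..<n}. mspace (X i))"
  show "(\<Sum>i<n. mdist (X i) (x i) (z i))
      \<le> (\<Sum>i<n. mdist (X i) (x i) (y i)) + (\<Sum>i<n. mdist (X i) (y i) (z i))"
    unfolding sum.distrib [symmetric]
    using x y z by (intro sum_mono mdist_triangle) (auto simp: PiE_iff)
qed

lemma mspace_l1_product [simp]: "mspace (l1_product n X) = (\<Pi>\<^sub>E i\<in>{..<n}. mspace (X i))"
  and mdist_l1_product [simp]:
    "mdist (l1_product n X) = (\<lambda>x y. \<Sum>i<n. mdist (X i) (x i) (y i))"
  using Metric_space_l1_product [of n X]
  by (auto simp: l1_product_def Metric_space.mspace_metric Metric_space.mdist_metric)

lemma walk_betw_rev:
  assumes "walk_betw V E u p v" shows "walk_betw V E v (rev p) u"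
  using assms
  by (auto simp: walk_betw_def is_walk_def hd_rev last_rev insert_commute successively_rev)

lemma walk_betw_append:
  assumes "walk_betw V E u p v" "walk_betw V E v q w"
  shows "walk_betw V E u (p @ tl q) w"
proof -
  obtain q' where q: "q = v # q'"
    using assms(2) by (cases q) (auto simp: walk_betw_def is_walk_def)
  show ?thesis
    using assms unfolding q
    by (cases q') (auto simp: walk_betw_def is_walk_def successively_append_iff)
qed

lemma graph_dist_walk:
  assumes "connected_graph V E" "u \<in> V" "v \<in> V"
  obtains p where "walk_betw V E u p v" "length p = Suc (graph_dist V E u v)"
proof -
  obtain p where p: "walk_betw V E u p v"
    using assms by (auto simp: connected_graph_def)
  then have "length p = Suc (length p - 1)"
    by (cases p) (auto simp: walk_betw_def is_walk_def)
  with p have "\<exists>n p. walk_betw V E u p v \<and> length p = Suc n"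
    by blast
  then have "\<exists>p. walk_betw V E u p v \<and> length p = Suc (graph_dist V E u v)"
    unfolding graph_dist_def by (rule LeastI_ex)
  with that show thesis by blast
qed

lemma graph_dist_le:
  "walk_betw V E u p v \<Longrightarrow> length p = Suc n \<Longrightarrow> graph_dist V E u v \<le> n"
  unfolding graph_dist_def by (rule Least_le) blast

lemma graph_dist_commute: "graph_dist V E u v = graph_dist V E v u"
proof -
  have "(\<exists>p. walk_betw V E u p v \<and> length p = Suc n)
      \<longleftrightarrow> (\<exists>p. walk_betw V E v p u \<and> length p = Suc n)" for n
    by (metis walk_betw_rev length_rev)
  then show ?thesis by (simp add: graph_dist_def)
qed

lemma Metric_space_graph_dist:
  assumes "connected_graph V E"
  shows "Metric_space V (\<lambda>u v. real (graph_dist V E u v))"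
proof
  fix u v w
  show "0 \<le> real (graph_dist V E u v)" by simp
  show "real (graph_dist V E u v) = real (graph_dist V E v u)"
    by (simp add: graph_dist_commute)
  assume u: "u \<in> V" and v: "v \<in> V"
  show "real (graph_dist V E u v) = 0 \<longleftrightarrow> u = v"
  proof
    assume 0: "real (graph_dist V E u v) = 0"
    obtain p where "walk_betw V E u p v" "length p = Suc (graph_dist V E u v)"
      using graph_dist_walk [OF assms u v] .
    with 0 show "u = v"
      by (auto simp: walk_betw_def length_Suc_conv)
  next
    assume "u = v"
    with u have "walk_betw V E u [u] v"
      by (simp add: walk_betw_def is_walk_def)
    then have "graph_dist V E u v \<le> 0"
      by (rule graph_dist_le) simp
    then show "real (graph_dist V E u v) = 0" by simp
  qed
  assume w: "w \<in> V"
  obtain p where p: "walk_betw V E u p v" "length p = Suc (graph_dist V E u v)"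
    using graph_dist_walk [OF assms u v] .
  obtain q where q: "walk_betw V E v q w" "length q = Suc (graph_dist V E v w)"
    using graph_dist_walk [OF assms v w] .
  have "graph_dist V E u w \<le> graph_dist V E u v + graph_dist V E v w"
    by (rule graph_dist_le [OF walk_betw_append [OF p(1) q(1)]]) (use p q in simp)
  then show "real (graph_dist V E u w) \<le> real (graph_dist V E u v) + real (graph_dist V E v w)"
    by linarith
qed

lemma mspace_path_metric: "connected_graph V E \<Longrightarrow> mspace (path_metric V E) = V"
  and mdist_path_metric:
    "connected_graph V E \<Longrightarrow> mdist (path_metric V E) = (\<lambda>u v. real (graph_dist V E u v))"
  by (simp_all add: path_metric_def Metric_space.mspace_metric Metric_space.mdist_metric
      Metric_space_graph_dist)

context group
begin

lemma foldr_mult_closed: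
  "set w \<subseteq> carrier G \<Longrightarrow> foldr (mult G) w \<one> \<in> carrier G"
  by (induction w) auto

lemma foldr_mult_append:
  "set v \<subseteq> carrier G \<Longrightarrow> set w \<subseteq> carrier G \<Longrightarrow>
   foldr (mult G) (v @ w) \<one> = foldr (mult G) v \<one> \<otimes> foldr (mult G) w \<one>"
  by (induction v) (auto simp: foldr_mult_closed m_assoc simp del: foldr_append)

lemma foldr_mult_inv:
  "set w \<subseteq> carrier G \<Longrightarrow>
   foldr (mult G) (rev (map (m_inv G) w)) \<one> = inv (foldr (mult G) w \<one>)"
proof (induction w)
  case (Cons x w)
  then have "set (rev (map (m_inv G) w)) \<subseteq> carrier G" "x \<in> carrier G" by auto
  then have "foldr (mult G) (rev (map (m_inv G) (x # w))) \<one>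
      = foldr (mult G) (rev (map (m_inv G) w)) \<one> \<otimes> inv x"
    using foldr_mult_append [of "rev (map (m_inv G) w)" "[inv x]"] by simp
  with Cons show ?case
    by (simp add: foldr_mult_closed inv_mult_group)
qed simp

lemma generate_word:
  assumes S: "S \<subseteq> carrier G" and g: "g \<in> generate G S"
  shows "\<exists>w. set w \<subseteq> S \<union> m_inv G ` S \<and> foldr (mult G) w \<one> = g"
  using g
proof induction
  case one
  show ?case by (rule exI [of _ "[]"]) simp
next
  case (incl h)
  then show ?case using S by (intro exI [of _ "[h]"]) auto
next
  case (inv h)
  then show ?case using S by (intro exI [of _ "[inv h]"]) auto
next
  case (eng g h)
  then obtain v w where vw: "set v \<subseteq> S \<union> m_inv G ` S" "foldr (mult G) v \<one> = g"
    "set w \<subseteq> S \<union> m_inv G ` S" "foldr (mult G) w \<one> = h" by blast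
  moreover have "S \<union> m_inv G ` S \<subseteq> carrier G" using S by auto
  ultimately show ?case
    using foldr_mult_append [of v w] by (intro exI [of _ "v @ w"]) auto
qed

lemma word_length_word:
  assumes "generating_set G S" "g \<in> carrier G"
  obtains w where "set w \<subseteq> S \<union> m_inv G ` S" "length w = word_length G S g"
    "foldr (mult G) w \<one> = g"
proof -
  have "\<exists>n w. set w \<subseteq> S \<union> m_inv G ` S \<and> length w = n \<and> foldr (mult G) w \<one> = g"
    using generate_word assms unfolding generating_set_def by blast
  then have "\<exists>w. set w \<subseteq> S \<union> m_inv G ` S \<and> length w = word_length G S g
      \<and> foldr (mult G) w \<one> = g"
    unfolding word_length_def by (rule LeastI_ex)
  with that show thesis by blast
qed

lemma word_length_le:
  "set w \<subseteq> S \<union> m_inv G ` S \<Longrightarrow> foldr (mult G) w \<one> = g \<Longrightarrow> word_length G S g \<le> length w"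
  unfolding word_length_def by (rule Least_le) blast

lemma word_length_inv_le:
  assumes S: "generating_set G S" and g: "g \<in> carrier G"
  shows "word_length G S (inv g) \<le> word_length G S g"
proof -
  obtain w where w: "set w \<subseteq> S \<union> m_inv G ` S" "length w = word_length G S g"
    "foldr (mult G) w \<one> = g"
    using word_length_word [OF S g] .
  have SG: "S \<subseteq> carrier G" using S by (simp add: generating_set_def)
  have wG: "set w \<subseteq> carrier G" using w(1) SG inv_closed by blast
  have inv: "inv x \<in> S \<union> m_inv G ` S" if "x \<in> S \<union> m_inv G ` S" for x
    using that SG by (auto simp: subset_iff)
  have "set (rev (map (m_inv G) w)) \<subseteq> S \<union> m_inv G ` S"
    using w(1) inv by auto
  from word_length_le [OF this foldr_mult_inv [OF wG]] w show ?thesis by simp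
qed

lemma Metric_space_word_metric:
  assumes S: "generating_set G S"
  shows "Metric_space (carrier G)
    (\<lambda>g h. if g \<in> carrier G \<and> h \<in> carrier G then real (word_length G S (inv g \<otimes> h)) else 0)"
    (is "Metric_space _ ?d")
proof
  fix g h k
  show "0 \<le> ?d g h" by simp
  show "?d g h = ?d h g"
  proof (cases "g \<in> carrier G \<and> h \<in> carrier G")
    case True
    then have "inv (inv g \<otimes> h) = inv h \<otimes> g" "inv (inv h \<otimes> g) = inv g \<otimes> h"
      by (simp_all add: inv_mult_group)
    with True word_length_inv_le [OF S, of "inv g \<otimes> h"] word_length_inv_le [OF S, of "inv h \<otimes> g"]
    show ?thesis by simp
  qed auto
  assume g: "g \<in> carrier G" and h: "h \<in> carrier G"
  show "?d g h = 0 \<longleftrightarrow> g = h"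
  proof
    assume 0: "?d g h = 0"
    obtain w where "length w = word_length G S (inv g \<otimes> h)" "foldr (mult G) w \<one> = inv g \<otimes> h"
      using word_length_word [OF S, of "inv g \<otimes> h"] g h by blast
    with 0 g h have "inv g \<otimes> h = \<one>" by simp
    with g h show "g = h"
      by (metis inv_closed inv_equality inv_inv)
  next
    assume "g = h"
    then show "?d g h = 0"
      using g word_length_le [of "[]" S \<one>] by simp
  qed
  assume k: "k \<in> carrier G"
  obtain v where v: "set v \<subseteq> S \<union> m_inv G ` S" "length v = word_length G S (inv g \<otimes> h)"
    "foldr (mult G) v \<one> = inv g \<otimes> h"
    using word_length_word [OF S, of "inv g \<otimes> h"] g h by blast
  obtain w where w: "set w \<subseteq> S \<union> m_inv G ` S" "length w = word_length G S (inv h \<otimes> k)"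
    "foldr (mult G) w \<one> = inv h \<otimes> k"
    using word_length_word [OF S, of "inv h \<otimes> k"] h k by blast
  have "S \<subseteq> carrier G" using S by (simp add: generating_set_def)
  then have "S \<union> m_inv G ` S \<subseteq> carrier G" by auto
  then have "set v \<subseteq> carrier G" "set w \<subseteq> carrier G" using v(1) w(1) by blast+
  then have "foldr (mult G) (v @ w) \<one> = (inv g \<otimes> h) \<otimes> (inv h \<otimes> k)"
    using v w by (simp add: foldr_mult_append del: foldr_append)
  also have "\<dots> = inv g \<otimes> k"
    using g h k by (metis inv_closed inv_solve_left m_assoc m_closed)
  finally have "word_length G S (inv g \<otimes> k) \<le> length (v @ w)"
    using v w by (intro word_length_le) auto
  then show "?d g k \<le> ?d g h + ?d h k"
    using g h k v w by simp
qed

lemma mspace_word_metric: "generating_set G S \<Longrightarrow> mspace (word_metric G S) = carrier G"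
  and mdist_word_metric: "generating_set G S \<Longrightarrow> g \<in> carrier G \<Longrightarrow> h \<in> carrier G \<Longrightarrow>
    mdist (word_metric G S) g h = real (word_length G S (inv g \<otimes> h))"
  by (simp_all add: word_metric_def Metric_space.mspace_metric Metric_space.mdist_metric
      Metric_space_word_metric)

end

lemma isometric_action_diagonal:
  assumes "group G" and act: "\<And>i. i < n \<Longrightarrow> isometric_action G (X i) (\<phi> i)"
  shows "isometric_action G (l1_product n X) (diagonal_action n X \<phi>)"
proof -
  interpret group G by fact
  let ?P = "\<Pi>\<^sub>E i\<in>{..<n}. mspace (X i)"
  let ?\<phi> = "diagonal_action n X \<phi>"
  have ga: "group_action G (mspace (X i)) (\<phi> i)" if "i < n" for i
    using act that by (simp add: isometric_action_def)
  have closed: "\<phi> i g x \<in> mspace (X i)" if "i < n" "g \<in> carrier G" "x \<in> mspace (X i)" for i g x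
    using group_action.element_image [OF ga] that by blast
  have mem: "?\<phi> g x \<in> ?P" if "g \<in> carrier G" "x \<in> ?P" for g x
    using that closed by (auto simp: diagonal_action_def PiE_iff)
  have comp: "?\<phi> (g \<otimes>\<^bsub>G\<^esub> h) x = ?\<phi> g (?\<phi> h x)"
    if "g \<in> carrier G" "h \<in> carrier G" "x \<in> ?P" for g h x
  proof -
    have "\<phi> i (g \<otimes>\<^bsub>G\<^esub> h) (x i) = \<phi> i g (\<phi> i h (x i))" if "i < n" for i
      using group_action.composition_rule [OF ga] that \<open>g \<in> _\<close> \<open>h \<in> _\<close> \<open>x \<in> _\<close>
      by (auto simp: PiE_iff)
    then show ?thesis
      using that mem [OF that(2,3)] by (auto simp: diagonal_action_def intro!: restrict_ext)
  qed
  have one: "?\<phi> \<one>\<^bsub>G\<^esub> x = x" if "x \<in> ?P" for x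
  proof -
    have "\<phi> i \<one>\<^bsub>G\<^esub> (x i) = x i" if "i < n" for i
      using group_action.id_eq_one [OF ga] that \<open>x \<in> _\<close>
      by (metis PiE_mem lessThan_iff restrict_apply')
    then show ?thesis
      using that by (auto simp: diagonal_action_def PiE_iff extensional_def restrict_def)
  qed
  have bij: "?\<phi> g \<in> Bij ?P" if g: "g \<in> carrier G" for g
  proof -
    have "bij_betw (?\<phi> g) ?P ?P"
      by (rule bij_betw_byWitness [where f' = "?\<phi> (inv\<^bsub>G\<^esub> g)"])
        (use g mem one comp [symmetric] in auto)
    then show ?thesis by (auto simp: Bij_def diagonal_action_def)
  qed
  have "?\<phi> (g \<otimes>\<^bsub>G\<^esub> h) = compose ?P (?\<phi> g) (?\<phi> h)" if "g \<in> carrier G" "h \<in> carrier G" for g h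
  proof
    fix x
    show "?\<phi> (g \<otimes>\<^bsub>G\<^esub> h) x = compose ?P (?\<phi> g) (?\<phi> h) x"
      by (cases "x \<in> ?P") (use that comp in \<open>auto simp: compose_def diagonal_action_def\<close>)
  qed
  then have "?\<phi> \<in> hom G (BijGroup ?P)"
    using bij by (auto simp: hom_def BijGroup_def)
  then have "group_action G ?P ?\<phi>"
    by (simp add: group_action_def group_hom_def group_hom_axioms_def group_BijGroup \<open>group G\<close>)
  moreover have "mdist (X i) (\<phi> i g (x i)) (\<phi> i g (y i)) = mdist (X i) (x i) (y i)"
    if "i < n" "g \<in> carrier G" "x \<in> ?P" "y \<in> ?P" for i g x y
    using act [of i] that by (auto simp: isometric_action_def PiE_iff)
  ultimately show ?thesis
    by (simp add: isometric_action_def diagonal_action_def)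
qed

lemma equiv_pres_rel: "equiv UNIV (pres_rel R)"
proof (rule equivI)
  show "refl_on UNIV (pres_rel R)"
    by (simp add: refl_on_def pres_rel_def pres_refl)
  show "sym (pres_rel R)"
    unfolding sym_def pres_rel_def by (blast intro: pres_sym)
  show "trans (pres_rel R)"
    unfolding trans_def pres_rel_def by (blast intro: pres_trans)
qed simp

lemma pres_eq_append1: "pres_eq R u v \<Longrightarrow> pres_eq R (p @ u @ q) (p @ v @ q)"
proof (induction rule: pres_eq.induct)
  case (pres_cancel u s e v)
  then show ?case using pres_eq.pres_cancel [of R "p @ u" s e "v @ q"] by simp
next
  case (pres_relator r u v)
  then show ?case using pres_eq.pres_relator [of r R "p @ u" "v @ q"] by simp
next
  case (pres_trans u v w)
  from pres_trans.IH show ?case by (rule pres_eq.pres_trans)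
next
  case (pres_sym u v)
  from pres_sym.IH show ?case by (rule pres_eq.pres_sym)
qed (rule pres_eq.pres_refl)

lemma pres_eq_append: "pres_eq R u u' \<Longrightarrow> pres_eq R v v' \<Longrightarrow> pres_eq R (u @ v) (u' @ v')"
  using pres_eq_append1 [of R u u' "[]" v] pres_eq_append1 [of R v v' u' "[]"]
    pres_trans [of R "u @ v" "u' @ v" "u' @ v'"] by simp

lemma presented_group_mult:
  "(pres_rel R `` {u}) \<otimes>\<^bsub>presented_group R\<^esub> (pres_rel R `` {v}) = pres_rel R `` {u @ v}"
proof -
  have "pres_rel R `` {u' @ v'} = pres_rel R `` {u @ v}"
    if "u' \<in> pres_rel R `` {u}" "v' \<in> pres_rel R `` {v}" for u' v'
    using equiv_class_eq [OF equiv_pres_rel, of "u @ v" "u' @ v'" R] pres_eq_append [of R u u' v v']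
      that by (simp add: pres_rel_def)
  then have "(\<Union>u'\<in>pres_rel R `` {u}. \<Union>v'\<in>pres_rel R `` {v}. pres_rel R `` {u' @ v'})
      = (\<Union>u'\<in>pres_rel R `` {u}. \<Union>v'\<in>pres_rel R `` {v}. pres_rel R `` {u @ v})"
    by (intro SUP_cong refl)
  moreover have "u \<in> pres_rel R `` {u}" "v \<in> pres_rel R `` {v}"
    by (simp_all add: pres_rel_def pres_refl)
  ultimately show ?thesis
    unfolding presented_group_def monoid.simps by blast
qed

lemma pres_rel_Image_eq_iff: "pres_rel R `` {u} = pres_rel R `` {v} \<longleftrightarrow> pres_eq R u v"
  using eq_equiv_class_iff [OF equiv_pres_rel, of u v R] by (simp add: pres_rel_def)

lemma pres_eq_inverse: "pres_eq R (map (apsnd Not) (rev w) @ w) []"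
proof (induction w)
  case (Cons l w)
  obtain s e where l: "l = (s, e)" by fastforce
  have "pres_eq R (map (apsnd Not) (rev w) @ [(s, \<not> e), (s, \<not> \<not> e)] @ w)
      (map (apsnd Not) (rev w) @ w)"
    by (rule pres_cancel)
  from pres_trans [OF this Cons.IH] show ?case by (simp add: l)
qed (simp add: pres_refl)

lemma group_presented_group: "group (presented_group R)"
proof (rule groupI)
  note carrier = presented_group_def quotient_def
  show "\<one>\<^bsub>presented_group R\<^esub> \<in> carrier (presented_group R)"
    by (auto simp: carrier)
  have one: "\<one>\<^bsub>presented_group R\<^esub> = pres_rel R `` {[]}"
    by (simp add: presented_group_def)
  fix A assume "A \<in> carrier (presented_group R)"
  then obtain u where A: "A = pres_rel R `` {u}" by (auto simp: carrier)
  show "\<one>\<^bsub>presented_group R\<^esub> \<otimes>\<^bsub>presented_group R\<^esub> A = A"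
    by (simp add: A one presented_group_mult)
  have "(pres_rel R `` {map (apsnd Not) (rev u)}) \<otimes>\<^bsub>presented_group R\<^esub> A
      = \<one>\<^bsub>presented_group R\<^esub>"
    by (simp add: A one presented_group_mult pres_rel_Image_eq_iff pres_eq_inverse)
  then show "\<exists>B\<in>carrier (presented_group R).
      B \<otimes>\<^bsub>presented_group R\<^esub> A = \<one>\<^bsub>presented_group R\<^esub>"
    by (rule bexI) (auto simp: carrier)
  fix B assume "B \<in> carrier (presented_group R)"
  then obtain v where B: "B = pres_rel R `` {v}" by (auto simp: carrier)
  show "A \<otimes>\<^bsub>presented_group R\<^esub> B \<in> carrier (presented_group R)"
    unfolding A B presented_group_mult by (auto simp: carrier)
  fix C assume "C \<in> carrier (presented_group R)"
  then obtain w where C: "C = pres_rel R `` {w}" by (auto simp: carrier)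
  show "A \<otimes>\<^bsub>presented_group R\<^esub> B \<otimes>\<^bsub>presented_group R\<^esub> C
      = A \<otimes>\<^bsub>presented_group R\<^esub> (B \<otimes>\<^bsub>presented_group R\<^esub> C)"
    by (simp add: A B C presented_group_mult)
qed

text \<open>The universal property of the presentation.\<close>

definition eval_word :: "('g, 'm) monoid_scheme \<Rightarrow> ('s \<Rightarrow> 'g) \<Rightarrow> 's gword \<Rightarrow> 'g" where
  "eval_word H f w = foldr (mult H) (map (\<lambda>(s, e). if e then f s else m_inv H (f s)) w) (one H)"

lemma presented_group_universal:
  assumes "group H" and f: "\<And>s. f s \<in> carrier H" and R: "\<And>r. r \<in> R \<Longrightarrow> eval_word H f r = \<one>\<^bsub>H\<^esub>"
  shows "\<exists>h\<in>hom (presented_group R) H. \<forall>w. h (pres_rel R `` {w}) = eval_word H f w"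
proof -
  interpret H: group H by fact
  have letters: "set (map (\<lambda>(s, e). if e then f s else inv\<^bsub>H\<^esub> (f s)) w) \<subseteq> carrier H" for w
    using f by auto
  have closed: "eval_word H f w \<in> carrier H" for w
    unfolding eval_word_def using letters by (rule H.foldr_mult_closed)
  have append: "eval_word H f (u @ v) = eval_word H f u \<otimes>\<^bsub>H\<^esub> eval_word H f v" for u v
    unfolding eval_word_def map_append using letters letters by (rule H.foldr_mult_append)
  have eq: "eval_word H f u = eval_word H f v" if "pres_eq R u v" for u v
    using that
  proof induction
    case (pres_cancel u s e v)
    have "eval_word H f [(s, e), (s, \<not> e)] = \<one>\<^bsub>H\<^esub>"
      using f by (simp add: eval_word_def)
    then show ?case by (simp only: append) (simp add: closed)
  next
    case (pres_relator r u v)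
    then show ?case by (simp add: append R closed)
  qed auto
  define h where "h A = eval_word H f (SOME w. w \<in> A)" for A
  have h: "h (pres_rel R `` {w}) = eval_word H f w" for w
  proof -
    have "(SOME v. v \<in> pres_rel R `` {w}) \<in> pres_rel R `` {w}"
      by (rule someI [of _ w]) (simp add: pres_rel_def pres_refl)
    then show ?thesis unfolding h_def using eq by (simp add: pres_rel_def)
  qed
  have "h \<in> hom (presented_group R) H"
  proof (rule homI)
    fix A B assume "A \<in> carrier (presented_group R)" "B \<in> carrier (presented_group R)"
    then obtain u v where AB: "A = pres_rel R `` {u}" "B = pres_rel R `` {v}"
      by (auto simp: presented_group_def quotient_def)
    show "h A \<in> carrier H" by (simp add: AB h closed)
    show "h (A \<otimes>\<^bsub>presented_group R\<^esub> B) = h A \<otimes>\<^bsub>H\<^esub> h B"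
      by (simp add: AB presented_group_mult h append)
  qed
  with h show ?thesis by blast
qed

lemma group_triangle_group_333: "group triangle_group_333"
  by (simp add: triangle_group_333_def group_presented_group)

end

theory Submission
  imports Defs
begin

text \<open>
  The group acts on the plane \<open>x\<^sub>0 + x\<^sub>1 + x\<^sub>2 = 0\<close> as the affine Weyl group of type \<open>A\<^sub>2\<close>: the
  generators \<open>a\<close> and \<open>b\<close> permute the coordinates, \<open>c\<close> is an affine reflection, and the translation
  lattice, generated by \<open>(1,0,-1)\<close> and \<open>(0,1,-1)\<close>, has the dihedral group of order 6 as a complement.
  These reflections preserve the \<open>\<ell>\<^sup>1\<close>-metric on \<open>\<int>\<^sup>3\<close>, and the normal form (translation times element
  of the complement) shows that the orbit maps are quasi-isometric embeddings into this product of
  three quasi-lines.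

  Let the group act coboundedly on a hyperbolic space and let \<open>f n\<close> be the displacement of a base
  point by the \<open>n\<close>-th power of the translation \<open>(1,0,-1)\<close>. All roots are conjugate, so Gromov's
  four-point condition gives \<open>f (3 n) \<le> 2 f n + C\<close>. By coboundedness, translations move all points
  about equally far; comparing a base point with the midpoint of a geodesic gives
  \<open>f (2 n) \<ge> 2 f n - C\<close> whenever \<open>f n > C\<close>. Since \<open>f (4 n) \<le> f n + f (3 n)\<close>, the function \<open>f\<close> is
  bounded, so no finite product of such actions is proper.
\<close>

section \<open>Normal forms in the triangle group\<close>

context group
begin

lemma intertwine_int_pow:
  fixes k :: int
  assumes [simp]: "g \<in> carrier G" "x \<in> carrier G" "y \<in> carrier G" and gx: "g \<otimes> x = y \<otimes> g"
  shows "g \<otimes> x [^] k = y [^] k \<otimes> g"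
proof -
  have nat: "g \<otimes> x [^] n = y [^] n \<otimes> g" for n :: nat
  proof (induction n)
    case (Suc n)
    have "g \<otimes> x [^] Suc n = g \<otimes> x [^] n \<otimes> x" by (simp add: m_assoc)
    also have "\<dots> = y [^] n \<otimes> (g \<otimes> x)" by (simp add: Suc m_assoc)
    also have "\<dots> = y [^] Suc n \<otimes> g" by (simp add: gx m_assoc)
    finally show ?case .
  qed simp
  show ?thesis
  proof (cases k rule: int_cases2)
    case (nonneg n)
    then show ?thesis using nat by (simp add: int_pow_int)
  next
    case (nonpos n)
    have "inv (y [^] n) \<otimes> g \<otimes> x [^] n = g"
      by (simp add: m_assoc nat inv_solve_left')
    then have "inv (y [^] n) \<otimes> g = g \<otimes> inv (x [^] n)"
      by (simp add: inv_solve_right)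
    then show ?thesis using nonpos by (simp add: int_pow_neg_int)
  qed
qed

lemma word_length_mult_le:
  assumes S: "generating_set G S" and gh: "g \<in> carrier G" "h \<in> carrier G"
  shows "word_length G S (g \<otimes> h) \<le> word_length G S g + word_length G S h"
proof -
  obtain v where v: "set v \<subseteq> S \<union> m_inv G ` S" "length v = word_length G S g"
    "foldr (mult G) v \<one> = g"
    using word_length_word [OF S gh(1)] .
  obtain w where w: "set w \<subseteq> S \<union> m_inv G ` S" "length w = word_length G S h"
    "foldr (mult G) w \<one> = h"
    using word_length_word [OF S gh(2)] .
  have "S \<union> m_inv G ` S \<subseteq> carrier G" using S by (auto simp: generating_set_def)
  then have "set v \<subseteq> carrier G" "set w \<subseteq> carrier G" using v(1) w(1) by blast+
  then have "foldr (mult G) (v @ w) \<one> = g \<otimes> h"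
    using v w by (simp add: foldr_mult_append del: foldr_append)
  with v w show ?thesis
    using word_length_le [of "v @ w" S "g \<otimes> h"] by simp
qed

lemma word_length_int_pow_le:
  fixes k :: int
  assumes S: "generating_set G S" and g [simp]: "g \<in> carrier G"
  shows "word_length G S (g [^] k) \<le> nat \<bar>k\<bar> * word_length G S g"
proof -
  have nat: "word_length G S (g [^] n) \<le> n * word_length G S g" for n :: nat
  proof (induction n)
    case 0
    show ?case using word_length_le [of "[]" S \<one>] by simp
  next
    case (Suc n)
    then show ?case using word_length_mult_le [OF S, of "g [^] n" g] by simp
  qed
  show ?thesis
  proof (cases k rule: int_cases2)
    case (nonneg n)
    then show ?thesis using nat by (simp add: int_pow_int)
  next
    case (nonpos n)
    then show ?thesis
      using nat [of n] word_length_inv_le [OF S, of "g [^] n"] by (simp add: int_pow_neg_int)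
  qed
qed

end

text \<open>Every quotient of the triangle group satisfies these assumptions, so the infinite order
  of the translations cannot follow here; it comes from the lattice action below.\<close>

locale triangle_333 = group +
  fixes a b c
  assumes gens [simp]: "a \<in> carrier G" "b \<in> carrier G" "c \<in> carrier G"
    and sq: "a \<otimes> a = \<one>" "b \<otimes> b = \<one>" "c \<otimes> c = \<one>"
    and rel: "(a \<otimes> b) [^] (3::nat) = \<one>"
      "(b \<otimes> c) [^] (3::nat) = \<one>" "(a \<otimes> c) [^] (3::nat) = \<one>"
    and generated: "generate G {a, b, c} = carrier G"
begin

section \<open>Rewriting with the Coxeter relations\<close>

lemma cancel:
  assumes "x \<in> carrier G"
  shows "a \<otimes> (a \<otimes> x) = x" "b \<otimes> (b \<otimes> x) = x" "c \<otimes> (c \<otimes> x) = x"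
  using assms by (simp_all add: m_assoc [symmetric] sq)

lemma inv_gens [simp]: "inv a = a" "inv b = b" "inv c = c"
  by (simp_all add: inv_equality sq)

text \<open>The cube relation says that \<open>x \<otimes> (y \<otimes> x)\<close> is inverse to
  \<open>y \<otimes> (x \<otimes> y)\<close>, and the latter is an involution.\<close>

lemma braid_aux:
  assumes [simp]: "x \<in> carrier G" "y \<in> carrier G" and "x \<otimes> x = \<one>" "y \<otimes> y = \<one>"
    and xy: "(x \<otimes> y) [^] (3::nat) = \<one>"
  shows "x \<otimes> (y \<otimes> x) = y \<otimes> (x \<otimes> y)"
proof -
  have i: "inv x = x" "inv y = y" by (simp_all add: inv_equality assms)
  have "x \<otimes> (y \<otimes> x) \<otimes> (y \<otimes> (x \<otimes> y)) = \<one>"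
    using xy by (simp add: numeral_3_eq_3 m_assoc)
  then have "x \<otimes> (y \<otimes> x) = inv (y \<otimes> (x \<otimes> y))"
    by (simp add: inv_equality [symmetric])
  also have "\<dots> = y \<otimes> (x \<otimes> y)" by (simp add: inv_mult_group i m_assoc)
  finally show ?thesis .
qed

text \<open>Each equation lowers a word lexicographically for the order a < b < c and keeps its
  length, so rewriting with it and with the shortening rules \<open>cancel\<close>
  terminates.\<close>

lemma braid:
  "b \<otimes> (a \<otimes> b) = a \<otimes> (b \<otimes> a)" "c \<otimes> (b \<otimes> c) = b \<otimes> (c \<otimes> b)" "c \<otimes> (a \<otimes> c) = a \<otimes> (c \<otimes> a)"
  using braid_aux [of a b] braid_aux [of b c] braid_aux [of a c] sq rel by simp_all

lemma braid':
  assumes "x \<in> carrier G"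
  shows "b \<otimes> (a \<otimes> (b \<otimes> x)) = a \<otimes> (b \<otimes> (a \<otimes> x))"
    "c \<otimes> (b \<otimes> (c \<otimes> x)) = b \<otimes> (c \<otimes> (b \<otimes> x))"
    "c \<otimes> (a \<otimes> (c \<otimes> x)) = a \<otimes> (c \<otimes> (a \<otimes> x))"
  using assms braid by (simp_all add: m_assoc [symmetric])

text \<open>In the plane, \<open>a \<otimes> (b \<otimes> a)\<close> exchanges coordinates 0 and 2
  and \<open>c\<close> is a reflection in a parallel mirror, so \<open>u\<close> is the translation
  by (1,0,-1). Its conjugate \<open>v\<close> under \<open>a\<close> is the translation by
  (0,1,-1).\<close>

definition u where "u = c \<otimes> (a \<otimes> (b \<otimes> a))"
definition v where "v = a \<otimes> (c \<otimes> (a \<otimes> b))"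

lemma uv_closed [simp]: "u \<in> carrier G" "v \<in> carrier G"
  by (simp_all add: u_def v_def)

lemma uv_commute: "u \<otimes> v = v \<otimes> u"
proof -
  have "v \<otimes> u = (a \<otimes> (c \<otimes> a)) \<otimes> (b \<otimes> (c \<otimes> (a \<otimes> (b \<otimes> a))))"
    by (simp add: u_def v_def m_assoc)
  \<comment> \<open>Here \<open>braid\<close> is applied against its orientation: \<open>aca\<close>
    becomes \<open>cac\<close>, which creates the subword \<open>cbc\<close>.\<close>
  also have "\<dots> = c \<otimes> (a \<otimes> ((c \<otimes> (b \<otimes> c)) \<otimes> (a \<otimes> (b \<otimes> a))))"
    by (simp add: braid(3) [symmetric] m_assoc)
  also have "\<dots> = u \<otimes> v"
    by (simp add: u_def v_def braid braid' cancel sq m_assoc)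
  finally show ?thesis by simp
qed

lemma a_u: "a \<otimes> u = v \<otimes> a"
  by (simp add: u_def v_def m_assoc)

lemma a_v: "a \<otimes> v = u \<otimes> a"
  by (simp add: u_def v_def m_assoc cancel sq)

lemma inv_v: "inv v = b \<otimes> (a \<otimes> (c \<otimes> a))"
  by (simp add: v_def inv_mult_group m_assoc)

text \<open>\<open>b\<close> exchanges coordinates 1 and 2, hence negates (0,1,-1) and, in
  \<open>b_u\<close>, sends (1,0,-1) to (1,-1,0).\<close>

lemma b_v: "b \<otimes> v = inv v \<otimes> b"
  by (simp add: inv_v) (simp add: v_def m_assoc)

lemma b_u: "b \<otimes> u = (u \<otimes> inv v) \<otimes> b"
  by (simp add: inv_v) (simp add: u_def m_assoc cancel braid braid' sq)


text \<open>The translation by (m, n, -m-n). In these coordinates \<open>a_tr\<close> and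
  \<open>b_tr\<close> are transpositions of entries.\<close>

definition tr :: "int \<Rightarrow> int \<Rightarrow> 'a" where
  "tr m n = u [^] m \<otimes> v [^] n"

lemma tr_closed [simp]: "tr m n \<in> carrier G"
  by (simp add: tr_def)

lemma tr_0 [simp]: "tr 0 0 = \<one>"
  by (simp add: tr_def)

lemma uv_pow_commute: "v [^] (n::int) \<otimes> u [^] (m::int) = u [^] m \<otimes> v [^] n"
proof -
  have "u \<otimes> v [^] n = v [^] n \<otimes> u"
    using uv_commute by (intro intertwine_int_pow) auto
  then show ?thesis by (intro intertwine_int_pow) auto
qed

lemma tr_mult: "tr m n \<otimes> tr m' n' = tr (m + m') (n + n')"
proof -
  have "tr m n \<otimes> tr m' n' = u [^] m \<otimes> ((v [^] n \<otimes> u [^] m') \<otimes> v [^] n')"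
    by (simp add: tr_def m_assoc)
  then show ?thesis
    by (simp add: uv_pow_commute tr_def int_pow_mult m_assoc)
qed

lemma inv_tr: "inv (tr m n) = tr (- m) (- n)"
  by (rule inv_equality) (simp_all add: tr_mult)

lemma a_tr: "a \<otimes> tr m n = tr n m \<otimes> a"
proof -
  have "a \<otimes> tr m n = v [^] m \<otimes> (a \<otimes> v [^] n)"
    using intertwine_int_pow [OF _ _ _ a_u, of m] by (simp add: tr_def m_assoc [symmetric])
  also have "\<dots> = tr n m \<otimes> a"
    using intertwine_int_pow [OF _ _ _ a_v, of n]
    by (simp add: tr_def m_assoc [symmetric] uv_pow_commute)
  finally show ?thesis .
qed

lemma b_tr: "b \<otimes> tr m n = tr m (- m - n) \<otimes> b"
proof -
  have "u \<otimes> inv v = inv v \<otimes> u"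
    by (metis inv_closed inv_solve_left inv_solve_right m_assoc m_closed uv_closed uv_commute)
  then have "(u \<otimes> inv v) [^] m = u [^] m \<otimes> v [^] (- m)"
    using uv_pow_commute [of "- m" m]
    by (simp add: int_pow_mult_distrib int_pow_inv int_pow_neg)
  then have "b \<otimes> tr m n = u [^] m \<otimes> v [^] (- m) \<otimes> (b \<otimes> v [^] n)"
    using intertwine_int_pow [OF _ _ _ b_u, of m] by (simp add: tr_def m_assoc [symmetric])
  also have "\<dots> = u [^] m \<otimes> (v [^] (- m) \<otimes> v [^] (- n)) \<otimes> b"
    using intertwine_int_pow [OF _ _ _ b_v, of n]
    by (simp add: m_assoc int_pow_inv int_pow_neg)
  also have "\<dots> = tr m (- m - n) \<otimes> b"
    by (simp add: tr_def int_pow_mult [symmetric] m_assoc)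
  finally show ?thesis .
qed

lemma c_eq: "c = tr 1 0 \<otimes> (a \<otimes> (b \<otimes> a))"
  by (simp add: tr_def u_def m_assoc cancel sq)

text \<open>The generators are involutions, so words without inverse letters suffice.\<close>

lemma generator_induct [consumes 1, case_names one gen]:
  assumes "g \<in> carrier G" and one: "P \<one>"
    and gen: "\<And>s x. s \<in> {a, b, c} \<Longrightarrow> x \<in> carrier G \<Longrightarrow> P x \<Longrightarrow> P (s \<otimes> x)"
  shows "P g"
proof -
  obtain w where w: "set w \<subseteq> {a, b, c} \<union> m_inv G ` {a, b, c}" "foldr (mult G) w \<one> = g"
    using generate_word [of "{a, b, c}" g] generated assms by auto
  have "set w \<subseteq> {a, b, c}" using w(1) by auto
  then have "foldr (mult G) w \<one> \<in> carrier G \<and> P (foldr (mult G) w \<one>)"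
    by (induction w) (use gen one in auto)
  with w show ?thesis by simp
qed

definition W where "W = {\<one>, a, b, a \<otimes> b, b \<otimes> a, a \<otimes> (b \<otimes> a)}"

lemma W_closed: "w \<in> W \<Longrightarrow> w \<in> carrier G"
  by (auto simp: W_def)

lemma finite_W: "finite W"
  by (simp add: W_def)

lemma W_mult: "w \<in> W \<Longrightarrow> a \<otimes> w \<in> W" "w \<in> W \<Longrightarrow> b \<otimes> w \<in> W"
  by (auto simp: W_def cancel braid braid' sq)

text \<open>Left multiplication by \<open>a\<close> or \<open>b\<close> passes the translation and
  is absorbed by \<open>W\<close>; \<open>c_eq\<close> reduces \<open>c\<close> to three such steps
  and one more translation.\<close>

lemma normal_form:
  assumes "g \<in> carrier G"
  obtains m n w where "w \<in> W" "g = tr m n \<otimes> w"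
proof -
  have ab: "\<exists>m' n' w'. w' \<in> W \<and> s \<otimes> (tr m n \<otimes> w) = tr m' n' \<otimes> w'"
    if "w \<in> W" "s \<in> {a, b}" for s m n w
    using that W_mult [of w] W_closed [of w]
    by (auto simp: m_assoc [symmetric] a_tr b_tr) (metis gens m_assoc tr_closed W_closed)+
  from assms have "\<exists>m n w. w \<in> W \<and> g = tr m n \<otimes> w"
  proof (induction rule: generator_induct)
    case one
    show ?case by (intro exI [of _ 0] exI [of _ \<one>]) (simp add: W_def)
  next
    case (gen s x)
    then obtain m n w where x: "x = tr m n \<otimes> w" and w: "w \<in> W" by blast
    show ?case
    proof (cases "s = c")
      case False
      then show ?thesis using ab [of w s m n] gen x w by auto
    next
      case True
      obtain m1 n1 w1 where 1: "w1 \<in> W" "a \<otimes> x = tr m1 n1 \<otimes> w1"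
        using ab [of w a m n] x w by auto
      obtain m2 n2 w2 where 2: "w2 \<in> W" "b \<otimes> (a \<otimes> x) = tr m2 n2 \<otimes> w2"
        using ab [of w1 b m1 n1] 1 by auto
      obtain m3 n3 w3 where 3: "w3 \<in> W" "a \<otimes> (b \<otimes> (a \<otimes> x)) = tr m3 n3 \<otimes> w3"
        using ab [of w2 a m2 n2] 2 by auto
      have "c \<otimes> x = tr 1 0 \<otimes> (a \<otimes> (b \<otimes> (a \<otimes> x)))"
        by (subst c_eq) (simp add: gen m_assoc)
      also have "\<dots> = tr (1 + m3) n3 \<otimes> w3"
        by (simp add: 3 W_closed m_assoc [symmetric] tr_mult)
      finally show ?thesis using True 3(1) by blast
    qed
  qed
  with that show thesis by blast
qed

section \<open>Word lengths of the two factors of the normal form\<close>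

lemma generating: "generating_set G {a, b, c}"
  using generated by (simp add: generating_set_def)

lemma word_length_W:
  assumes "w \<in> W"
  shows "word_length G {a, b, c} w \<le> 3"
proof -
  have "\<exists>l. set l \<subseteq> {a, b, c} \<and> length l \<le> 3 \<and> foldr (mult G) l \<one> = w"
    using assms unfolding W_def
    apply safe
         apply (rule exI [of _ "[]"], simp)
        apply (rule exI [of _ "[a]"], simp)
       apply (rule exI [of _ "[b]"], simp)
      apply (rule exI [of _ "[a, b]"], simp)
     apply (rule exI [of _ "[b, a]"], simp)
    apply (rule exI [of _ "[a, b, a]"], simp)
    done
  then show ?thesis using word_length_le [of _ "{a, b, c}" w] by fastforce
qed

lemma word_length_tr: "word_length G {a, b, c} (tr m n) \<le> 4 * nat \<bar>m\<bar> + 4 * nat \<bar>n\<bar>"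
proof -
  have "word_length G {a, b, c} u \<le> 4"
    using word_length_le [of "[c, a, b, a]" "{a, b, c}" u] by (simp add: u_def)
  moreover have "word_length G {a, b, c} v \<le> 4"
    using word_length_le [of "[a, c, a, b]" "{a, b, c}" v] by (simp add: v_def)
  ultimately have "word_length G {a, b, c} (u [^] m) \<le> nat \<bar>m\<bar> * 4"
    "word_length G {a, b, c} (v [^] n) \<le> nat \<bar>n\<bar> * 4"
    using word_length_int_pow_le [OF generating, of u m] word_length_int_pow_le [OF generating, of v n]
    by (meson le_trans mult_le_mono2 uv_closed)+
  then show ?thesis
    using word_length_mult_le [OF generating, of "u [^] m" "v [^] n"] by (simp add: tr_def)
qed

end

section \<open>Cobounded actions on hyperbolic spaces\<close>

text \<open>Gromov's inequality with base point \<open>s\<close>, multiplied by 2 to clear the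
  halves in the products; hence \<open>2 * \<delta>\<close>.\<close>

lemma gromov_four_point:
  assumes "gromov_hyperbolic \<delta> X"
    and "p \<in> mspace X" "q \<in> mspace X" "r \<in> mspace X" "s \<in> mspace X"
  shows "mdist X p q + mdist X r s
    \<le> max (mdist X p r + mdist X q s) (mdist X p s + mdist X q r) + 2 * \<delta>"
proof -
  have "gromov_product X s p q \<ge> min (gromov_product X s p r) (gromov_product X s r q) - \<delta>"
    using assms by (simp add: gromov_hyperbolic_def)
  then show ?thesis
    using mdist_commute [of X r q]
    by (auto simp: gromov_product_def min_def max_def field_simps split: if_splits)
qed

lemma geodesic_midpoint:
  assumes "geodesic_space X" "x \<in> mspace X" "y \<in> mspace X"
  obtains m where "m \<in> mspace X" "mdist X x m = mdist X x y / 2" "mdist X m y = mdist X x y / 2"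
proof -
  let ?d = "mdist X x y"
  obtain \<gamma> where \<gamma>: "\<gamma> \<in> {0..?d} \<rightarrow> mspace X" "\<gamma> 0 = x" "\<gamma> ?d = y"
    "\<And>s t. s \<in> {0..?d} \<Longrightarrow> t \<in> {0..?d} \<Longrightarrow> mdist X (\<gamma> s) (\<gamma> t) = \<bar>s - t\<bar>"
    using assms unfolding geodesic_space_def by blast
  have I: "0 \<in> {0..?d}" "?d / 2 \<in> {0..?d}" "?d \<in> {0..?d}" by auto
  show thesis
    using \<gamma>(1) \<gamma>(4) [OF I(1,2)] \<gamma>(4) [OF I(2,3)] I(2)
    by (intro that [of "\<gamma> (?d / 2)"]) (auto simp: \<gamma>(2,3))
qed

text \<open>Meant for \<open>y = t x\<close>, \<open>z = t y\<close> and \<open>m' = t m\<close>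
  with an isometry \<open>t\<close>. One four-point inequality bounds the distance from
  \<open>x\<close> to \<open>m'\<close>, a second one then that from \<open>m\<close> to
  \<open>m'\<close>.\<close>

lemma midpoint_displacement:
  assumes hyp: "\<delta> \<ge> 0" "gromov_hyperbolic \<delta> X"
    and mem: "x \<in> mspace X" "y \<in> mspace X" "z \<in> mspace X" "m \<in> mspace X" "m' \<in> mspace X"
    and d: "mdist X y z = mdist X x y"
    and m: "mdist X x m = mdist X x y / 2" "mdist X m y = mdist X x y / 2"
    and m': "mdist X y m' = mdist X x y / 2" "mdist X m' z = mdist X x y / 2"
  shows "mdist X m m' \<le> max (mdist X x z - mdist X x y) 0 + 4 * \<delta>"
proof -
  note four_point = gromov_four_point [OF hyp(2)]
  have "mdist X m' x \<le> max (mdist X x y / 2) (mdist X x z - mdist X x y / 2) + 2 * \<delta>"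
    using four_point [of m' x y z] mem d m' mdist_commute [of X m' y]
    by (auto simp: max_def split: if_splits)
  moreover have "mdist X m m' \<le> max (mdist X m' x - mdist X x y / 2) 0 + 2 * \<delta>"
    using four_point [of m m' y x] mem m m' mdist_commute [of X y x] mdist_commute [of X m x]
      mdist_commute [of X m' y]
    by (auto simp: max_def split: if_splits)
  ultimately show ?thesis
    using hyp(1) by (auto simp: max_def split: if_splits)
qed

context triangle_333
begin

lemma displacement_tr_bounded:
  assumes hyp: "hyperbolic_space X" and iso: "isometric_action G X \<phi>"
    and cob: "cobounded_action G X \<phi>"
  shows "\<exists>x\<in>mspace X. \<exists>B. \<forall>n. mdist X x (\<phi> (tr n 0) x) \<le> B"
proof -
  obtain \<delta> where geo: "geodesic_space X" and \<delta>: "\<delta> \<ge> 0" "gromov_hyperbolic \<delta> X"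
    using hyp by (auto simp: hyperbolic_space_def)
  obtain x \<epsilon> where x: "x \<in> mspace X" and "\<epsilon> \<ge> 0"
    and dense: "\<And>y. y \<in> mspace X \<Longrightarrow> \<exists>z\<in>orbit G \<phi> x. mdist X y z \<le> \<epsilon>"
    using cob unfolding cobounded_action_def by blast
  interpret act: group_action G "mspace X" \<phi>
    using iso by (simp add: isometric_action_def)
  have isom: "mdist X (\<phi> g y) (\<phi> g z) = mdist X y z"
    if "g \<in> carrier G" "y \<in> mspace X" "z \<in> mspace X" for g y z
    using iso that by (simp add: isometric_action_def)
  have mem [simp]: "\<phi> g y \<in> mspace X" if "g \<in> carrier G" "y \<in> mspace X" for g y
    using act.element_image that by blast
  have comp: "\<phi> (g \<otimes> h) y = \<phi> g (\<phi> h y)"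
    if "g \<in> carrier G" "h \<in> carrier G" "y \<in> mspace X" for g h y
    using act.composition_rule that by blast
  define disp where "disp g = mdist X x (\<phi> g x)" for g
  have disp_nonneg: "disp g \<ge> 0" for g by (simp add: disp_def)
  have dist: "mdist X (\<phi> g x) (\<phi> (g \<otimes> h) x) = disp h" if "g \<in> carrier G" "h \<in> carrier G" for g h
    using that x by (simp add: comp isom disp_def)
  have disp_mult: "disp (g \<otimes> h) \<le> disp g + disp h" if "g \<in> carrier G" "h \<in> carrier G" for g h
    using mdist_triangle [of x X "\<phi> g x" "\<phi> (g \<otimes> h) x"] that x dist by (simp add: disp_def)
  have disp_inv: "disp (inv g) = disp g" if "g \<in> carrier G" for g
  proof -
    have "\<phi> \<one> x = x" using act.id_eq_one x by (metis restrict_apply')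
    then show ?thesis
      using dist [of g "inv g"] that by (simp add: disp_def mdist_commute)
  qed
  have conj: "disp h \<le> disp k + 2 * disp g"
    if "g \<otimes> h = k \<otimes> g" "g \<in> carrier G" "h \<in> carrier G" "k \<in> carrier G" for g h k
  proof -
    have "h = inv g \<otimes> (k \<otimes> g)" using that by (simp add: inv_solve_left)
    then show ?thesis
      using disp_mult [of "inv g" "k \<otimes> g"] disp_mult [of k g] disp_inv [of g] that by simp
  qed
  \<comment> \<open>By \<open>conj\<close>, conjugation by \<open>g\<close> costs
    \<open>2 * disp g\<close>; \<open>K\<close> pays for \<open>a\<close> as well as for
    \<open>b\<close>.\<close>
  define K where "K = 2 * disp a + 2 * disp b"
  have swap: "disp (tr m n) \<le> disp (tr n m) + K" "disp (tr m n) \<le> disp (tr m (- m - n)) + K" for m n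
    using conj [OF a_tr [of m n]] conj [OF b_tr [of m n]] disp_nonneg [of a] disp_nonneg [of b]
    by (simp_all add: K_def)
  have neg: "disp (tr (- m) (- n)) = disp (tr m n)" for m n
    using disp_inv [of "tr m n"] by (simp add: inv_tr)
  \<comment> \<open>\<open>3(1,0,-1) = (1,1,-2) + (2,-1,-1)\<close>, both summands are conjugate up to inversion, and the
    four-point condition for the parallelogram spanned by \<open>(1,0,-1)\<close> and \<open>(0,-1,1)\<close> bounds its
    diagonal \<open>(1,1,-2)\<close>.\<close>
  have triple: "disp (tr (3 * n) 0) \<le> 2 * disp (tr n 0) + (10 * K + 4 * \<delta>)" for n
  proof -
    let ?g = "tr n 0" and ?h = "tr 0 (- n)"
    have gh: "?g \<otimes> ?h = tr n (- n)" "?h \<otimes> ?g = tr n (- n)" "?g \<otimes> tr (- n) (- n) = ?h"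
      by (simp_all add: tr_mult)
    have "disp (tr n (- n)) + disp (tr (- n) (- n)) \<le> max (2 * disp ?g) (2 * disp ?h) + 2 * \<delta>"
      using gromov_four_point [OF \<delta>(2), of x "\<phi> (tr n (- n)) x" "\<phi> ?g x" "\<phi> ?h x"] x
        dist [of ?g ?h] dist [of ?h ?g] dist [of ?g "tr (- n) (- n)"]
      by (simp add: gh mdist_commute disp_def)
    \<comment> \<open>The diagonal \<open>tr n (- n)\<close> is a multiple of a root, so it is
      nearly as long as \<open>?g\<close>; its lower bound cancels one of the two copies of the side
      length.\<close>
    moreover have "disp ?h \<le> disp ?g + K" "disp ?g \<le> disp (tr n (- n)) + K"
      using swap(1) [of 0 n] swap(2) [of n 0] neg [of 0 n] by simp_all
    ultimately have nn: "disp (tr n n) \<le> disp ?g + 3 * K + 2 * \<delta>"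
      using neg [of n n] disp_nonneg [of a] disp_nonneg [of b] by (simp add: K_def max_def split: if_splits)
    \<comment> \<open>Negating (2,-1,-1) gives (-2,1,1), which \<open>a\<close> and then
      \<open>b\<close> permute to (1,1,-2).\<close>
    have "disp (tr (2 * n) (- n)) \<le> disp (tr n n) + 2 * K"
      using neg [of "2 * n" "- n"] swap(1) [of "- 2 * n" n] swap(2) [of n "- 2 * n"] by simp
    moreover have "disp (tr (3 * n) 0) \<le> disp (tr n n) + disp (tr (2 * n) (- n))"
      using disp_mult [of "tr n n" "tr (2 * n) (- n)"] by (simp add: tr_mult)
    ultimately show ?thesis
      using nn disp_nonneg [of a] disp_nonneg [of b] by (simp add: K_def)
  qed
  \<comment> \<open>Coboundedness and commutativity of the translations: \<open>tr n 0\<close> moves all points by about the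
    same amount, since every orbit point is a translate of one of the finitely many points \<open>\<phi> w x\<close>.\<close>
  define E where "E = 2 * \<epsilon> + 2 * (\<Sum>w\<in>W. disp w)"
  have displacement: "disp (tr n 0) \<le> mdist X y (\<phi> (tr n 0) y) + E" if y: "y \<in> mspace X" for n y
  proof -
    let ?t = "tr n 0"
    obtain g where g: "g \<in> carrier G" and yg: "mdist X y (\<phi> g x) \<le> \<epsilon>"
      using dense [OF y] by (auto simp: orbit_def)
    obtain p q w where w: "w \<in> W" and gw: "g = tr p q \<otimes> w"
      using normal_form [OF g] .
    note [simp] = W_closed [OF w]
    have "disp w \<le> (\<Sum>w\<in>W. disp w)"
      using w finite_W disp_nonneg by (intro member_le_sum) auto
    moreover have "disp ?t \<le> disp w + mdist X (\<phi> w x) (\<phi> ?t (\<phi> w x)) + disp w"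
    proof -
      have "disp w = mdist X (\<phi> ?t (\<phi> w x)) (\<phi> ?t x)"
        using x by (simp add: isom disp_def mdist_commute)
      then show ?thesis
        using mdist_triangle [of x X "\<phi> w x" "\<phi> ?t x"]
          mdist_triangle [of "\<phi> w x" X "\<phi> ?t (\<phi> w x)" "\<phi> ?t x"] x
        by (simp add: disp_def)
    qed
    moreover have "mdist X (\<phi> w x) (\<phi> ?t (\<phi> w x)) = mdist X (\<phi> g x) (\<phi> ?t (\<phi> g x))"
    proof -
      have "\<phi> ?t (\<phi> g x) = \<phi> (tr p q) (\<phi> ?t (\<phi> w x))"
        using x by (simp add: gw comp [symmetric] m_assoc [symmetric] tr_mult add.commute)
      then show ?thesis using x by (simp add: gw comp isom)
    qed
    moreover have "mdist X (\<phi> g x) (\<phi> ?t (\<phi> g x)) \<le> 2 * \<epsilon> + mdist X y (\<phi> ?t y)"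
    proof -
      have "mdist X (\<phi> ?t y) (\<phi> ?t (\<phi> g x)) \<le> \<epsilon>"
        using x y g yg by (simp add: isom)
      then show ?thesis
        using mdist_triangle [of "\<phi> g x" X y "\<phi> ?t (\<phi> g x)"]
          mdist_triangle [of y X "\<phi> ?t y" "\<phi> ?t (\<phi> g x)"] x y g yg
        by (simp add: mdist_commute)
    qed
    ultimately show ?thesis by (simp add: E_def)
  qed
  define C where "C = 4 * \<delta> + E"
  \<comment> \<open>The alternatives are the two arguments of the maximum in
    \<open>midpoint_displacement\<close>, applied to the midpoint of \<open>x\<close> and
    \<open>\<phi> (tr n 0) x\<close>.\<close>
  have double: "disp (tr n 0) \<le> C \<or> disp (tr (2 * n) 0) \<ge> 2 * disp (tr n 0) - C" for n
  proof -
    let ?t = "tr n 0"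
    obtain m where m: "m \<in> mspace X" "mdist X x m = disp ?t / 2" "mdist X m (\<phi> ?t x) = disp ?t / 2"
      using geodesic_midpoint [OF geo x, of "\<phi> ?t x"] x by (auto simp: disp_def)
    have tt: "\<phi> (tr (2 * n) 0) x = \<phi> ?t (\<phi> ?t x)"
      using x by (simp add: comp [symmetric] tr_mult)
    have "mdist X m (\<phi> ?t m) \<le> max (mdist X x (\<phi> ?t (\<phi> ?t x)) - mdist X x (\<phi> ?t x)) 0 + 4 * \<delta>"
      using m x by (intro midpoint_displacement [OF \<delta>, where y = "\<phi> ?t x"])
        (simp_all add: isom disp_def)
    then show ?thesis
      using displacement [OF m(1), of n] by (simp add: C_def tt disp_def max_def split: if_splits)
  qed
  \<comment> \<open>If \<open>double\<close> gives growth at \<open>n\<close> and at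
    \<open>2 * n\<close>, then \<open>disp (tr (4 * n) 0)\<close> is at least
    \<open>4 * disp (tr n 0) - 3 * C\<close>, but subadditivity and \<open>triple\<close> bound it
    by \<open>3 * disp (tr n 0)\<close> plus a constant. Otherwise
    \<open>disp (tr n 0) \<le> C\<close>.\<close>
  have "disp (tr n 0) \<le> 3 * C + (10 * K + 4 * \<delta>)" for n
  proof -
    have "disp (tr (4 * n) 0) \<le> disp (tr n 0) + disp (tr (3 * n) 0)"
      using disp_mult [of "tr n 0" "tr (3 * n) 0"] by (simp add: tr_mult)
    moreover have "C \<ge> 0" "K \<ge> 0"
      using \<delta> \<open>\<epsilon> \<ge> 0\<close> disp_nonneg by (simp_all add: C_def E_def K_def sum_nonneg)
    ultimately show ?thesis
      using triple [of n] double [of n] double [of "2 * n"] \<delta>(1) by auto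
  qed
  with x show ?thesis unfolding disp_def by blast
qed

text \<open>Adding the bounds of the factors gives one point of the product that infinitely many
  translations move by at most \<open>R\<close>.\<close>

lemma not_has_PH0:
  assumes inj: "inj (\<lambda>n. tr n 0)"
  shows "\<not> has_PH0 TYPE('x) G"
proof
  assume "has_PH0 TYPE('x) G"
  then obtain n and X :: "nat \<Rightarrow> 'x metric" and \<phi> where
    X: "\<And>i. i < n \<Longrightarrow> hyperbolic_space (X i) \<and> isometric_action G (X i) (\<phi> i) \<and>
      cobounded_action G (X i) (\<phi> i)"
    and proper: "proper_action G (l1_product n X) (diagonal_action n X \<phi>)"
    unfolding has_PH0_def by blast
  have "\<forall>i. \<exists>x B. i < n \<longrightarrow> x \<in> mspace (X i) \<and> (\<forall>k. mdist (X i) x (\<phi> i (tr k 0) x) \<le> B)"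
    using displacement_tr_bounded X by blast
  then obtain x B where xB: "\<And>i. i < n \<Longrightarrow> x i \<in> mspace (X i)"
    "\<And>i k. i < n \<Longrightarrow> mdist (X i) (x i) (\<phi> i (tr k 0) (x i)) \<le> B i"
    by metis
  define p where "p = (\<lambda>i\<in>{..<n}. x i)"
  have p: "p \<in> mspace (l1_product n X)" using xB by (auto simp: p_def)
  \<comment> \<open>The summand 1 makes \<open>R\<close> positive even for the empty product, as
    \<open>proper_action\<close> demands.\<close>
  define R where "R = (\<Sum>i<n. \<bar>B i\<bar>) + 1"
  have "mdist (l1_product n X) p (diagonal_action n X \<phi> (tr k 0) p) \<le> R" for k
  proof -
    have "mdist (l1_product n X) p (diagonal_action n X \<phi> (tr k 0) p)
        = (\<Sum>i<n. mdist (X i) (x i) (\<phi> i (tr k 0) (x i)))"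
      using p by (auto simp: diagonal_action_def p_def intro!: sum.cong)
    also have "\<dots> \<le> (\<Sum>i<n. \<bar>B i\<bar>)"
      using xB(2) by (intro sum_mono) (meson abs_ge_self lessThan_iff order_trans)
    finally show ?thesis by (simp add: R_def)
  qed
  then have "range (\<lambda>k. tr k 0)
      \<subseteq> {g \<in> carrier G. mdist (l1_product n X) p (diagonal_action n X \<phi> g p) \<le> R}"
    by auto
  moreover have "R > 0" by (simp add: R_def add_nonneg_pos sum_nonneg)
  ultimately have "finite (range (\<lambda>k. tr k 0))"
    using proper p finite_subset unfolding proper_action_def by blast
  with inj show False using finite_imageD [of "\<lambda>k. tr k 0" UNIV] infinite_UNIV_int by blast
qed

end

section \<open>The integer line as a tree\<close>

lemma successively_unit_step_diff_le:
  "successively (\<lambda>i j::int. \<bar>i - j\<bar> = 1) q \<Longrightarrow> q \<noteq> [] \<Longrightarrow> \<bar>hd q - last q\<bar> \<le> int (length q) - 1"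
  by (induction q rule: induct_list012) auto

text \<open>The line is carried along an injection \<open>f\<close> because
  \<open>quasi_tree\<close> prescribes the type of the vertices.\<close>

definition line_edges :: "(int \<Rightarrow> 'v) \<Rightarrow> 'v set set" where
  "line_edges f = range (\<lambda>k. {f k, f (k + 1)})"

context
  fixes f :: "int \<Rightarrow> 'v"
  assumes f: "inj f"
begin

lemma line_edge_iff: "{f i, f j} \<in> line_edges f \<longleftrightarrow> \<bar>i - j\<bar> = 1"
proof
  assume "{f i, f j} \<in> line_edges f"
  then show "\<bar>i - j\<bar> = 1"
    using f by (auto simp: line_edges_def doubleton_eq_iff inj_eq)
next
  assume "\<bar>i - j\<bar> = 1"
  then consider "j = i + 1" | "i = j + 1" by linarith
  then show "{f i, f j} \<in> line_edges f"
    by cases (auto simp: line_edges_def insert_commute)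
qed

lemma line_walkE:
  assumes "is_walk (range f) (line_edges f) p"
  obtains q where "p = map f q" "q \<noteq> []" "successively (\<lambda>i j. \<bar>i - j\<bar> = 1) q"
proof -
  have "p \<in> lists (range f)" using assms by (auto simp: is_walk_def)
  then obtain q where "p = map f q" by (auto simp: lists_image)
  with assms that show thesis
    by (auto simp: is_walk_def successively_map line_edge_iff)
qed

lemma line_walk_up:
  "walk_betw (range f) (line_edges f) (f k) (map (\<lambda>i. f (k + int i)) [0..<Suc n]) (f (k + int n))"
proof -
  have "successively (\<lambda>i j. {f (k + int i), f (k + int j)} \<in> line_edges f) [0..<Suc n]"
    unfolding line_edge_iff by (induction n) (auto simp: successively_append_iff)
  then show ?thesis
    unfolding walk_betw_def is_walk_def
    by (auto simp: successively_map hd_map last_map simp del: upt_Suc)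
qed

lemma line_walk:
  obtains p where "walk_betw (range f) (line_edges f) (f k) p (f l)"
    "length p = Suc (nat \<bar>k - l\<bar>)"
proof (cases "k \<le> l")
  case True
  then show thesis
    using line_walk_up [of k "nat (l - k)"] by (intro that) (auto simp: abs_if)
next
  case False
  then show thesis
    using walk_betw_rev [OF line_walk_up [of l "nat (k - l)"]] by (intro that) (auto simp: abs_if)
qed

lemma line_connected: "connected_graph (range f) (line_edges f)"
  unfolding connected_graph_def using line_walk by blast

lemma line_graph_dist: "graph_dist (range f) (line_edges f) (f k) (f l) = nat \<bar>k - l\<bar>"
proof (rule antisym)
  show "graph_dist (range f) (line_edges f) (f k) (f l) \<le> nat \<bar>k - l\<bar>"
    using line_walk [of k l] graph_dist_le by metis
  obtain p where p: "walk_betw (range f) (line_edges f) (f k) p (f l)"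
    "length p = Suc (graph_dist (range f) (line_edges f) (f k) (f l))"
    using graph_dist_walk [OF line_connected, of "f k" "f l"] by blast
  then obtain q where q: "p = map f q" "q \<noteq> []" "successively (\<lambda>i j. \<bar>i - j\<bar> = 1) q"
    using line_walkE by (metis walk_betw_def)
  have "hd q = k" "last q = l"
    using p(1) q(1,2) f by (auto simp: walk_betw_def hd_map last_map inj_eq)
  then show "nat \<bar>k - l\<bar> \<le> graph_dist (range f) (line_edges f) (f k) (f l)"
    using successively_unit_step_diff_le [OF q(3,2)] p(2) q(1) by simp
qed

text \<open>A closed walk whose vertices are distinct never turns back, so it moves in one direction only.\<close>

lemma line_no_cycle: "\<not> is_cycle (range f) (line_edges f) p"
proof
  assume cyc: "is_cycle (range f) (line_edges f) p"
  then obtain q where q: "p = map f q" "q \<noteq> []" "successively (\<lambda>i j. \<bar>i - j\<bar> = 1) q"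
    using line_walkE by (metis is_cycle_def)
  have len: "length q \<ge> 4" and closed: "hd q = last q"
    using cyc q(1,2) f by (simp_all add: is_cycle_def hd_map last_map inj_eq)
  have "distinct (map f (tl q))" using cyc q(1) by (simp add: is_cycle_def map_tl)
  then have dist: "distinct (tl q)" by (simp add: distinct_map)
  have step: "\<bar>q ! i - q ! Suc i\<bar> = 1" if "Suc i < length q" for i
    using q(3) that by (simp add: successively_conv_nth)
  have neq: "q ! Suc i \<noteq> q ! Suc j" if "Suc i < length q" "Suc j < length q" "i \<noteq> j" for i j
    using dist that by (simp add: nth_tl [symmetric] distinct_conv_nth)
  have last: "q ! 0 = q ! (length q - 1)"
    using closed q(2) by (simp add: hd_conv_nth last_conv_nth)
  have no_turn: "q ! i \<noteq> q ! Suc (Suc i)" if "Suc (Suc i) < length q" for i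
  proof (cases i)
    case 0
    \<comment> \<open>Distinctness covers only the tail, so the first vertex is replaced by the
      equal last one, whose index is at least 3 and thus differs from 2.\<close>
    have "q ! Suc (length q - 2) \<noteq> q ! Suc 1"
      using len by (intro neq) linarith+
    moreover have "Suc (length q - 2) = length q - 1" using len by linarith
    ultimately show ?thesis using last 0 by simp
  next
    case (Suc j)
    then show ?thesis using neq [of j "Suc (Suc j)"] that by simp
  qed
  have dir: "q ! Suc i - q ! i = q ! 1 - q ! 0" if "Suc i < length q" for i
    using that
  proof (induction i)
    case (Suc i)
    then show ?case using step [of i] step [of "Suc i"] no_turn [of i] by (simp add: abs_if split: if_splits)
  qed simp
  have "q ! i = q ! 0 + int i * (q ! 1 - q ! 0)" if "i < length q" for i
    using that
  proof (induction i)
    case (Suc i)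
    then show ?case using dir [of i] by (simp add: algebra_simps)
  qed simp
  \<comment> \<open>Closing up after a positive number of equal steps forces the step to be
    0.\<close>
  from this [of "length q - 1"] last len have "int (length q - 1) * (q ! 1 - q ! 0) = 0"
    by simp
  moreover have "int (length q - 1) \<noteq> 0" using len by linarith
  ultimately have "q ! 1 = q ! 0" by simp
  then show False using step [of 0] len by simp
qed

lemma line_is_tree: "is_tree (range f) (line_edges f)"
proof -
  have "simple_graph (range f) (line_edges f)"
    unfolding simple_graph_def
  proof
    fix e assume "e \<in> line_edges f"
    then obtain k where "e = {f k, f (k + 1)}" by (auto simp: line_edges_def)
    moreover have "f k \<noteq> f (k + 1)" using f by (simp add: inj_eq)
    ultimately show "\<exists>u\<in>range f. \<exists>v\<in>range f. u \<noteq> v \<and> e = {u, v}" by blast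
  qed
  then show ?thesis by (simp add: is_tree_def line_connected line_no_cycle)
qed

end

abbreviation integer_line :: "real metric" where
  "integer_line \<equiv> submetric euclidean_metric \<int>"

lemma quasi_tree_integer_line: "quasi_tree integer_line"
proof -
  \<comment> \<open>The second component is mere padding to the vertex type; with this tree the
    floor map is an isometry.\<close>
  define f :: "int \<Rightarrow> real \<times> nat" where "f k = (of_int k, 0)" for k
  have f: "inj f" by (auto simp: inj_def f_def)
  note conn = line_connected [OF f]
  have "qi_embedding integer_line (path_metric (range f) (line_edges f)) (\<lambda>x. f \<lfloor>x\<rfloor>)"
    unfolding qi_embedding_def
    by (intro conjI exI [of _ 1] exI [of _ 0])
      (auto simp: mspace_path_metric [OF conn] mdist_path_metric [OF conn] line_graph_dist [OF f]
        dist_real_def elim!: Ints_cases)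
  moreover have "\<exists>x\<in>mspace integer_line.
      mdist (path_metric (range f) (line_edges f)) (f \<lfloor>x\<rfloor>) y \<le> 0"
    if "y \<in> range f" for y
    using that
    by (auto simp: mdist_path_metric [OF conn] line_graph_dist [OF f])
      (metis Ints_of_int floor_of_int diff_self abs_zero nat_0)
  ultimately have "quasi_isometry integer_line (path_metric (range f) (line_edges f)) (\<lambda>x. f \<lfloor>x\<rfloor>)"
    unfolding quasi_isometry_def mspace_path_metric [OF conn] by blast
  with line_is_tree [OF f] show ?thesis
    unfolding quasi_tree_def by blast
qed

section \<open>The action on the integer lattice\<close>

text \<open>The restriction makes points extensional, as elements of the product space must
  be.\<close>

definition point :: "real \<Rightarrow> real \<Rightarrow> real \<Rightarrow> nat \<Rightarrow> real" where
  "point p q r = (\<lambda>i\<in>{..<3}. if i = 0 then p else if i = 1 then q else r)"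

lemma point_simps [simp]:
  "point p q r 0 = p" "point p q r (Suc 0) = q" "point p q r 2 = r"
  by (simp_all add: point_def)

abbreviation lattice_metric :: "(nat \<Rightarrow> real) metric" where
  "lattice_metric \<equiv> l1_product 3 (\<lambda>_. integer_line)"

abbreviation lattice :: "(nat \<Rightarrow> real) set" where
  "lattice \<equiv> mspace lattice_metric"

lemma point_in_lattice [simp]: "point p q r \<in> lattice \<longleftrightarrow> p \<in> \<int> \<and> q \<in> \<int> \<and> r \<in> \<int>"
  by (auto simp: point_def PiE_iff numeral_3_eq_3 lessThan_Suc split: if_splits)

lemma lattice_cases:
  assumes "x \<in> lattice"
  obtains p q r where "x = point p q r" "p \<in> \<int>" "q \<in> \<int>" "r \<in> \<int>"
proof
  show "x = point (x 0) (x 1) (x 2)"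
  proof
    fix i :: nat
    consider "i = 0" | "i = 1" | "i = 2" | "i \<ge> 3" by linarith
    then show "x i = point (x 0) (x 1) (x 2) i"
      using assms by cases (auto simp: point_def PiE_iff extensional_def)
  qed
  show "x 0 \<in> \<int>" "x 1 \<in> \<int>" "x 2 \<in> \<int>" using assms by (auto simp: PiE_iff)
qed

lemma mdist_point [simp]:
  "mdist lattice_metric (point p q r) (point p' q' r') = \<bar>p - p'\<bar> + \<bar>q - q'\<bar> + \<bar>r - r'\<bar>"
  by (simp add: dist_real_def numeral_3_eq_3 point_def)

declare mspace_l1_product [simp del] mdist_l1_product [simp del]

text \<open>Each map transposes two coordinates, \<open>gen_c\<close> also shifting them by 1 and
  -1. All preserve the coordinate sum, so each orbit in the lattice stays in a translate of the
  plane with sum 0.\<close>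

fun reflection :: "tri_gen \<Rightarrow> (nat \<Rightarrow> real) \<Rightarrow> nat \<Rightarrow> real" where
  "reflection gen_a x = point (x 1) (x 0) (x 2)"
| "reflection gen_b x = point (x 0) (x 2) (x 1)"
| "reflection gen_c x = point (x 2 + 1) (x 1) (x 0 - 1)"

lemma reflection_closed: "x \<in> lattice \<Longrightarrow> reflection s x \<in> lattice"
  by (cases s; elim lattice_cases) auto

lemma reflection_reflection: "x \<in> lattice \<Longrightarrow> reflection s (reflection s x) = x"
  by (cases s; elim lattice_cases) auto

lemma mdist_reflection:
  "x \<in> lattice \<Longrightarrow> y \<in> lattice \<Longrightarrow>
    mdist lattice_metric (reflection s x) (reflection s y) = mdist lattice_metric x y"
  by (cases s; elim lattice_cases) auto

section \<open>Orbit maps of the lattice action\<close>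

locale triangle_333_action = triangle_333 +
  fixes \<phi>
  assumes action: "group_action G lattice \<phi>"
    and \<phi>_gens: "x \<in> lattice \<Longrightarrow> \<phi> a x = reflection gen_a x"
      "x \<in> lattice \<Longrightarrow> \<phi> b x = reflection gen_b x"
      "x \<in> lattice \<Longrightarrow> \<phi> c x = reflection gen_c x"
begin

lemma \<phi>_closed [simp]: "g \<in> carrier G \<Longrightarrow> x \<in> lattice \<Longrightarrow> \<phi> g x \<in> lattice"
  using group_action.element_image [OF action] by blast

lemma \<phi>_mult:
  "g \<in> carrier G \<Longrightarrow> h \<in> carrier G \<Longrightarrow> x \<in> lattice \<Longrightarrow> \<phi> (g \<otimes> h) x = \<phi> g (\<phi> h x)"
  using group_action.composition_rule [OF action] by blast

lemma \<phi>_one: "x \<in> lattice \<Longrightarrow> \<phi> \<one> x = x"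
  using group_action.id_eq_one [OF action] by (metis restrict_apply')

lemma mdist_\<phi>:
  assumes "g \<in> carrier G" "x \<in> lattice" "y \<in> lattice"
  shows "mdist lattice_metric (\<phi> g x) (\<phi> g y) = mdist lattice_metric x y"
  using assms
  by (induction rule: generator_induct) (auto simp: \<phi>_one \<phi>_mult \<phi>_gens mdist_reflection
      simp del: reflection.simps)

lemma isometric: "isometric_action G lattice_metric \<phi>"
  unfolding isometric_action_def using action mdist_\<phi> by blast

lemma \<phi>_translation_pow:
  fixes k :: int and i j l :: int
  assumes [simp]: "g \<in> carrier G"
    and g: "\<And>p q r. p \<in> \<int> \<Longrightarrow> q \<in> \<int> \<Longrightarrow> r \<in> \<int> \<Longrightarrow>
      \<phi> g (point p q r) = point (p + of_int i) (q + of_int j) (r + of_int l)"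
    and pqr: "p \<in> \<int>" "q \<in> \<int>" "r \<in> \<int>"
  shows "\<phi> (g [^] k) (point p q r) = point (p + k * i) (q + k * j) (r + k * l)"
proof -
  have nat: "\<phi> (g [^] n) (point p q r) = point (p + n * i) (q + n * j) (r + n * l)"
    if "p \<in> \<int>" "q \<in> \<int>" "r \<in> \<int>" for n :: nat and p q r :: real
    using that by (induction n arbitrary: p q r) (simp_all add: \<phi>_one \<phi>_mult g algebra_simps)
  show ?thesis
  proof (cases k rule: int_cases2)
    case (nonneg n)
    then show ?thesis using nat pqr by (simp add: int_pow_int)
  next
    case (nonpos n)
    \<comment> \<open>For a negative exponent, the claimed image is moved back by the positive
      power.\<close>
    have "point p q r = \<phi> (g [^] n) (point (p + k * i) (q + k * j) (r + k * l))"
      using nonpos pqr by (simp add: nat)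
    then have "\<phi> (g [^] k) (point p q r)
        = \<phi> (g [^] k \<otimes> g [^] n) (point (p + k * i) (q + k * j) (r + k * l))"
      using pqr by (simp add: \<phi>_mult)
    also have "g [^] k \<otimes> g [^] n = \<one>"
      using nonpos by (simp add: int_pow_neg_int)
    finally show ?thesis using pqr by (simp add: \<phi>_one)
  qed
qed

lemma \<phi>_tr:
  assumes "p \<in> \<int>" "q \<in> \<int>" "r \<in> \<int>"
  shows "\<phi> (tr m n) (point p q r) = point (p + of_int m) (q + of_int n) (r - of_int m - of_int n)"
proof -
  have "\<phi> u (point p q r) = point (p + of_int 1) (q + of_int 0) (r + of_int (- 1))"
    "\<phi> v (point p q r) = point (p + of_int 0) (q + of_int 1) (r + of_int (- 1))"
    if "p \<in> \<int>" "q \<in> \<int>" "r \<in> \<int>" for p q r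
    using that by (simp_all add: u_def v_def \<phi>_mult \<phi>_gens)
  note uv = this
  show ?thesis
    using assms
    by (simp add: tr_def \<phi>_mult \<phi>_translation_pow [OF _ uv(1)] \<phi>_translation_pow [OF _ uv(2)]
        diff_diff_eq add.commute)
qed

lemma inj_tr: "inj (\<lambda>n. tr n 0)"
proof (rule injI)
  fix m n
  assume "tr m 0 = tr n 0"
  then have "\<phi> (tr m 0) (point 0 0 0) 0 = \<phi> (tr n 0) (point 0 0 0) 0" by simp
  then show "m = n" by (simp add: \<phi>_tr)
qed

lemma displacement_tr:
  assumes "x \<in> lattice"
  shows "mdist lattice_metric x (\<phi> (tr m n) x) \<ge> \<bar>m\<bar> + \<bar>n\<bar>"
  using assms by (elim lattice_cases) (simp add: \<phi>_tr)

text \<open>The triangle inequality along a shortest word: every letter adds at most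
  \<open>M\<close>.\<close>

lemma displacement_le_word_length:
  assumes x: "x \<in> lattice"
    and M: "\<And>s. s \<in> {a, b, c} \<Longrightarrow> mdist lattice_metric x (\<phi> s x) \<le> M"
    and g: "g \<in> carrier G"
  shows "mdist lattice_metric x (\<phi> g x) \<le> M * word_length G {a, b, c} g"
proof -
  obtain w where w: "set w \<subseteq> {a, b, c} \<union> m_inv G ` {a, b, c}"
    "length w = word_length G {a, b, c} g" "foldr (mult G) w \<one> = g"
    using word_length_word [OF generating g] .
  have "set w \<subseteq> {a, b, c}" using w(1) by auto
  then have "foldr (mult G) w \<one> \<in> carrier G \<and>
      mdist lattice_metric x (\<phi> (foldr (mult G) w \<one>) x) \<le> M * length w"
  proof (induction w)
    case Nil
    have "mdist lattice_metric x x \<le> 0"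
      by (rule eq_refl) (use mdist_zero [OF x x] in blast)
    then show ?case using x by (simp add: \<phi>_one)
  next
    case (Cons s w)
    let ?h = "foldr (mult G) w \<one>"
    have s: "s \<in> {a, b, c}" "s \<in> carrier G" and h: "?h \<in> carrier G"
      and IH: "mdist lattice_metric x (\<phi> ?h x) \<le> M * length w"
      using Cons by auto
    have "mdist lattice_metric x (\<phi> s (\<phi> ?h x))
        \<le> mdist lattice_metric x (\<phi> s x) + mdist lattice_metric (\<phi> s x) (\<phi> s (\<phi> ?h x))"
      using x s h by (intro mdist_triangle) auto
    also have "\<dots> \<le> M + M * length w"
      using M [OF s(1)] IH x s h by (simp add: mdist_\<phi>)
    finally show ?case using x s h by (simp add: \<phi>_mult algebra_simps)
  qed
  with w show ?thesis by simp
qed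

text \<open>In the normal form the translation part controls both sides: its word length is at most
  4 times \<open>\<bar>m\<bar> + \<bar>n\<bar>\<close>, and it moves \<open>\<phi> w x\<close> at
  least that sum. Passing from \<open>\<phi> w x\<close> to \<open>x\<close> costs
  \<open>K\<close>.\<close>

lemma word_length_le_displacement:
  assumes x: "x \<in> lattice"
    and K: "\<And>w. w \<in> W \<Longrightarrow> mdist lattice_metric x (\<phi> w x) \<le> K"
    and g: "g \<in> carrier G"
  shows "word_length G {a, b, c} g \<le> 4 * (mdist lattice_metric x (\<phi> g x) + K) + 3"
proof -
  obtain m n w where w: "w \<in> W" and g_eq: "g = tr m n \<otimes> w"
    using normal_form [OF g] .
  have wG [simp]: "w \<in> carrier G" using w by (rule W_closed)
  have "word_length G {a, b, c} g \<le> 4 * nat \<bar>m\<bar> + 4 * nat \<bar>n\<bar> + 3"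
    using word_length_mult_le [OF generating, of "tr m n" w] word_length_tr [of m n]
      word_length_W [OF w] g_eq by simp
  then have "real (word_length G {a, b, c} g) \<le> real (4 * nat \<bar>m\<bar> + 4 * nat \<bar>n\<bar> + 3)"
    by (rule of_nat_mono)
  then have "real (word_length G {a, b, c} g) \<le> 4 * (\<bar>m\<bar> + \<bar>n\<bar>) + 3"
    by simp
  moreover have "\<bar>m\<bar> + \<bar>n\<bar> \<le> mdist lattice_metric (\<phi> w x) (\<phi> g x)"
    using displacement_tr [of "\<phi> w x" m n] x by (simp add: g_eq \<phi>_mult)
  moreover have "mdist lattice_metric (\<phi> w x) (\<phi> g x)
      \<le> mdist lattice_metric (\<phi> w x) x + mdist lattice_metric x (\<phi> g x)"
    using x g by (intro mdist_triangle) auto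
  ultimately show ?thesis
    using K [OF w] by (simp add: mdist_commute)
qed

lemma qi_orbit_map:
  assumes x: "x \<in> lattice"
  shows "qi_embedding (word_metric G {a, b, c}) lattice_metric (\<lambda>g. \<phi> g x)"
proof -
  let ?d = "\<lambda>g. mdist lattice_metric x (\<phi> g x)"
  define M where "M = (\<Sum>s\<in>{a, b, c}. ?d s)"
  define K where "K = (\<Sum>w\<in>W. ?d w)"
  have M: "?d s \<le> M" if "s \<in> {a, b, c}" for s
    unfolding M_def using that by (intro member_le_sum) auto
  have K: "?d w \<le> K" if "w \<in> W" for w
    unfolding K_def using that finite_W by (intro member_le_sum) auto
  have "M \<ge> 0" "K \<ge> 0" by (simp_all add: M_def K_def sum_nonneg)
  \<comment> \<open>\<open>4 + M\<close> dominates the slopes 4 and \<open>M\<close> of the two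
    estimates; division by 4 turns the additive 3 into 3/4, rounded up to 1.\<close>
  have bounds: "mdist (word_metric G {a, b, c}) g h / (4 + M) - (K + 1)
        \<le> mdist lattice_metric (\<phi> g x) (\<phi> h x)"
      "mdist lattice_metric (\<phi> g x) (\<phi> h x)
        \<le> (4 + M) * mdist (word_metric G {a, b, c}) g h + (K + 1)"
    if gh: "g \<in> carrier G" "h \<in> carrier G" for g h
  proof -
    let ?k = "inv g \<otimes> h"
    let ?l = "real (word_length G {a, b, c} ?k)"
    have k [simp]: "?k \<in> carrier G" using gh by simp
    have "\<phi> h x = \<phi> g (\<phi> ?k x)"
      using x gh by (simp add: \<phi>_mult [symmetric] m_assoc [symmetric])
    then have d: "mdist lattice_metric (\<phi> g x) (\<phi> h x) = ?d ?k"
      using x gh by (simp add: mdist_\<phi>)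
    have "?l / (4 + M) \<le> ?l / 4"
      using \<open>M \<ge> 0\<close> by (intro divide_left_mono) auto
    moreover have "?l \<le> 4 * (?d ?k + K) + 3"
      using x K k by (rule word_length_le_displacement)
    ultimately have "?l / (4 + M) - (K + 1) \<le> ?d ?k" by argo
    then show "mdist (word_metric G {a, b, c}) g h / (4 + M) - (K + 1)
        \<le> mdist lattice_metric (\<phi> g x) (\<phi> h x)"
      using gh by (simp add: d mdist_word_metric [OF generating])
    have "?d ?k \<le> M * ?l"
      using displacement_le_word_length [OF x M k] .
    also have "\<dots> \<le> (4 + M) * ?l" by (intro mult_right_mono) auto
    finally show "mdist lattice_metric (\<phi> g x) (\<phi> h x)
        \<le> (4 + M) * mdist (word_metric G {a, b, c}) g h + (K + 1)"
      using gh \<open>K \<ge> 0\<close> by (simp add: d mdist_word_metric [OF generating])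
  qed
  show ?thesis
    unfolding qi_embedding_def mspace_word_metric [OF generating]
    using bounds x \<open>M \<ge> 0\<close> \<open>K \<ge> 0\<close>
    by (intro conjI exI [of _ "4 + M"] exI [of _ "K + 1"]) auto
qed

lemma has_QT: "has_QT TYPE(real) G"
  unfolding has_QT_def
  using quasi_tree_integer_line isometric qi_orbit_map generating group_axioms
  by (intro conjI exI [of _ "{a, b, c}"] exI [of _ 3] exI [of _ "\<lambda>_. integer_line"] exI [of _ \<phi>]) auto

end

section \<open>The presented group\<close>

abbreviation triangle_relators :: "tri_gen gword set" where
  "triangle_relators \<equiv>
     {word_pow (letter gen_a) 2, word_pow (letter gen_b) 2, word_pow (letter gen_c) 2,
      word_pow (letter gen_a @ letter gen_b) 3,
      word_pow (letter gen_b @ letter gen_c) 3,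
      word_pow (letter gen_a @ letter gen_c) 3}"

definition word_class :: "tri_gen gword \<Rightarrow> tri_gen gword set" where
  "word_class w = pres_rel triangle_relators `` {w}"

lemma word_class_mult:
  "word_class v \<otimes>\<^bsub>triangle_group_333\<^esub> word_class w = word_class (v @ w)"
  by (simp add: word_class_def triangle_group_333_def presented_group_mult)

lemma word_class_Nil: "word_class [] = \<one>\<^bsub>triangle_group_333\<^esub>"
  by (simp add: word_class_def triangle_group_333_def presented_group_def)

lemma word_class_relator: "r \<in> triangle_relators \<Longrightarrow> word_class r = \<one>\<^bsub>triangle_group_333\<^esub>"
  using pres_relator [of r triangle_relators "[]" "[]"]
  by (simp add: word_class_Nil [symmetric] word_class_def pres_rel_Image_eq_iff)

lemma carrier_triangle_group_333: "carrier triangle_group_333 = range word_class"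
  by (auto simp: word_class_def triangle_group_333_def presented_group_def quotient_def)

lemma word_class_inverse_letter:
  "word_class [(s, False)] = inv\<^bsub>triangle_group_333\<^esub> (word_class (letter s))"
proof -
  interpret group triangle_group_333 by (rule group_triangle_group_333)
  have "word_class ([] @ [(s, False), (s, \<not> False)] @ []) = word_class ([] @ [])"
    unfolding word_class_def pres_rel_Image_eq_iff by (rule pres_cancel)
  then show ?thesis
    by (intro inv_equality [symmetric])
      (simp_all add: word_class_mult letter_def word_class_Nil carrier_triangle_group_333)
qed

lemma triangle_333_triangle_group:
  "triangle_333 triangle_group_333 (word_class (letter gen_a)) (word_class (letter gen_b))
     (word_class (letter gen_c))"
proof -
  interpret group triangle_group_333 by (rule group_triangle_group_333)
  let ?S = "{word_class (letter gen_a), word_class (letter gen_b), word_class (letter gen_c)}"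
  have pow: "word_class w [^]\<^bsub>triangle_group_333\<^esub> (n::nat) = word_class (word_pow w n)" for w n
  proof (induction n)
    case (Suc n)
    have "word_class w [^]\<^bsub>triangle_group_333\<^esub> Suc n
        = word_class w \<otimes>\<^bsub>triangle_group_333\<^esub> word_class w [^]\<^bsub>triangle_group_333\<^esub> n"
      by (rule nat_pow_Suc2) (simp add: carrier_triangle_group_333)
    then show ?case by (simp only: Suc word_class_mult) (simp add: word_pow_def)
  qed (simp add: word_pow_def word_class_Nil)
  have "word_class w \<in> generate triangle_group_333 ?S" for w
  proof (induction w)
    case Nil
    show ?case by (simp add: word_class_Nil generate.one)
  next
    case (Cons l w)
    obtain s e where l: "l = (s, e)" by fastforce
    have s: "word_class (letter s) \<in> ?S" by (cases s) auto
    have "word_class [l] \<in> generate triangle_group_333 ?S"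
      using generate.incl [OF s] generate.inv [OF s]
      by (cases e) (simp_all add: l letter_def [symmetric] word_class_inverse_letter)
    from generate.eng [OF this Cons.IH] show ?case by (simp add: word_class_mult)
  qed
  moreover have "?S \<subseteq> carrier triangle_group_333" by (auto simp: carrier_triangle_group_333)
  ultimately have gen: "generate triangle_group_333 ?S = carrier triangle_group_333"
    using generate_incl [of ?S] by (simp only: carrier_triangle_group_333) blast
  have sq: "word_class (letter s) \<otimes>\<^bsub>triangle_group_333\<^esub> word_class (letter s)
      = \<one>\<^bsub>triangle_group_333\<^esub>" for s
    using word_class_relator [of "word_pow (letter s) 2"]
    by (cases s) (simp_all add: word_class_mult word_pow_def numeral_2_eq_2)
  show ?thesis
    by unfold_locales
      (use gen sq in \<open>auto simp: carrier_triangle_group_333 word_class_mult pow word_class_relator\<close>)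
qed

section \<open>The lattice action from the universal property\<close>

lemma reflection_in_Bij: "restrict (reflection s) lattice \<in> Bij lattice"
proof -
  have "bij_betw (restrict (reflection s) lattice) lattice lattice"
    by (rule bij_betw_byWitness [where f' = "restrict (reflection s) lattice"])
      (auto simp: reflection_closed reflection_reflection)
  then show ?thesis by (simp add: Bij_def)
qed

lemma carrier_BijGroup: "carrier (BijGroup S) = Bij S"
  by (simp add: BijGroup_def)

lemma one_BijGroup: "x \<in> S \<Longrightarrow> \<one>\<^bsub>BijGroup S\<^esub> x = x"
  by (simp add: BijGroup_def)

lemma BijGroup_mult_apply:
  "f \<in> carrier (BijGroup S) \<Longrightarrow> g \<in> carrier (BijGroup S) \<Longrightarrow> x \<in> S \<Longrightarrow>
    (f \<otimes>\<^bsub>BijGroup S\<^esub> g) x = f (g x)"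
  by (simp add: BijGroup_def compose_def)

text \<open>Reduces the relators, which contain no inverse letters, to computations with
  coordinates.\<close>

lemma eval_word_reflections:
  assumes "x \<in> lattice"
  shows "eval_word (BijGroup lattice) (\<lambda>s. restrict (reflection s) lattice) (map (\<lambda>s. (s, True)) l) x
    = foldr reflection l x" (is "?E l x = _")
proof -
  interpret group "BijGroup lattice" by (rule group_BijGroup)
  have refl: "restrict (reflection s) lattice \<in> carrier (BijGroup lattice)" for s
    unfolding carrier_BijGroup by (rule reflection_in_Bij)
  have "?E l \<in> carrier (BijGroup lattice) \<and> ?E l x = foldr reflection l x \<and> foldr reflection l x \<in> lattice"
  proof (induction l)
    case Nil
    then show ?case using assms one_closed by (simp add: eval_word_def one_BijGroup)
  next
    case (Cons s l)
    have "?E (s # l) = restrict (reflection s) lattice \<otimes>\<^bsub>BijGroup lattice\<^esub> ?E l"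
      by (simp only: eval_word_def list.map prod.case if_True foldr.simps o_apply)
    with Cons refl show ?case
      using assms by (simp add: BijGroup_mult_apply reflection_closed)
  qed
  then show ?thesis by blast
qed

lemma triangle_group_333_action:
  obtains \<phi> where "triangle_333_action triangle_group_333 (word_class (letter gen_a))
    (word_class (letter gen_b)) (word_class (letter gen_c)) \<phi>"
proof -
  let ?B = "BijGroup lattice"
  let ?f = "\<lambda>s. restrict (reflection s) lattice"
  interpret B: group ?B by (rule group_BijGroup)
  have f: "?f s \<in> carrier ?B" for s
    unfolding carrier_BijGroup by (rule reflection_in_Bij)
  have ext: "eval_word ?B ?f (map (\<lambda>s. (s, True)) l) = \<one>\<^bsub>?B\<^esub>"
    if l: "\<And>x. x \<in> lattice \<Longrightarrow> foldr reflection l x = x" for l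
  proof (rule extensionalityI)
    have "set (map (\<lambda>(s, e). if e then ?f s else inv\<^bsub>?B\<^esub> (?f s)) (map (\<lambda>s. (s, True)) l))
        \<subseteq> carrier ?B"
      using f by auto
    then have "eval_word ?B ?f (map (\<lambda>s. (s, True)) l) \<in> carrier ?B"
      unfolding eval_word_def by (rule B.foldr_mult_closed)
    then show "eval_word ?B ?f (map (\<lambda>s. (s, True)) l) \<in> extensional lattice"
      by (simp only: carrier_BijGroup Bij_def Int_iff)
    show "\<one>\<^bsub>?B\<^esub> \<in> extensional lattice"
      using B.one_closed by (simp only: carrier_BijGroup Bij_def Int_iff)
    fix x assume "x \<in> lattice"
    then show "eval_word ?B ?f (map (\<lambda>s. (s, True)) l) x = \<one>\<^bsub>?B\<^esub> x"
      by (simp only: eval_word_reflections l one_BijGroup)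
  qed
  have "eval_word ?B ?f r = \<one>\<^bsub>?B\<^esub>" if "r \<in> triangle_relators" for r
  proof -
    \<comment> \<open>The relators with their powers written out, as lists of generators.\<close>
    let ?L = "{[gen_a, gen_a], [gen_b, gen_b], [gen_c, gen_c],
      [gen_a, gen_b, gen_a, gen_b, gen_a, gen_b], [gen_b, gen_c, gen_b, gen_c, gen_b, gen_c],
      [gen_a, gen_c, gen_a, gen_c, gen_a, gen_c]}"
    have "r \<in> map (\<lambda>s. (s, True)) ` ?L"
      using that by (simp add: word_pow_def letter_def numeral_2_eq_2 numeral_3_eq_3)
    moreover have "foldr reflection l x = x" if "x \<in> lattice" "l \<in> ?L" for l x
      using that(1)
    proof (rule lattice_cases)
      fix p q r assume "x = point p q r"
      then show ?thesis using that(2) by auto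
    qed
    ultimately show ?thesis using ext by blast
  qed
  from presented_group_universal [OF group_BijGroup, of ?f, OF f this]
  obtain \<phi> where hom: "\<phi> \<in> hom triangle_group_333 ?B"
    and \<phi>: "\<And>w. \<phi> (word_class w) = eval_word ?B ?f w"
    unfolding triangle_group_333_def word_class_def by blast
  have "\<phi> (word_class (letter s)) x = reflection s x" if "x \<in> lattice" for s x
    using eval_word_reflections [OF that, of "[s]"]
    by (simp only: \<phi> letter_def list.map foldr.simps o_apply id_apply)
  moreover have "group_action triangle_group_333 lattice \<phi>"
    using hom
    by (simp add: group_action_def group_hom_def group_hom_axioms_def group_BijGroup
        group_triangle_group_333)
  ultimately show thesis
    using triangle_333_triangle_group
    by (intro that [of \<phi>]) (simp add: triangle_333_action_def triangle_333_action_axioms_def)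
qed

theorem proposition1p9:
  shows "has_QT TYPE(real) triangle_group_333 \<and> \<not> has_PH0 TYPE('x) triangle_group_333"
proof -
  obtain \<phi> where "triangle_333_action triangle_group_333 (word_class (letter gen_a))
    (word_class (letter gen_b)) (word_class (letter gen_c)) \<phi>"
    using triangle_group_333_action .
  then interpret triangle_333_action triangle_group_333 "word_class (letter gen_a)"
    "word_class (letter gen_b)" "word_class (letter gen_c)" \<phi> .
  \<comment> \<open>The lattice action serves both halves: its orbit maps give QT, and it separates
    the translations for the failure of PH0.\<close>
  show ?thesis using has_QT not_has_PH0 [OF inj_tr] by blast
qed

end
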